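(* Let $f:\omega\to\omega$ be not densely computable. Then $\mu(\{X\subseteq\omega : f \text{ is densely computable relative to } X\})=0$; indeed, no element of this class is weakly $4$-random relative to $f$. Consequently, for every set $A\subseteq\omega$ that is not densely computable, the classes $\{X : A\le_{\mathrm{ud}} X\}$ and $\{X: A\le_{\mathrm{nd}} X\}$ have measure $0$.
   Context: $\mu$ is Lebesgue (fair-coin) measure on $2^\omega$, identifying sets with their characteristic sequences. For $A\subseteq\omega$, $\rho_n(A)=|A\cap\{0,\dots,n-1\}|/n$ and $\rho(A)=\lim_n\rho_n(A)$ when it exists. A dense description of $g:\omega\to\omega$ is a partial function $d$ with $\rho(\{n: d(n)=g(n)\})=1$. $g$ is densely computable (relative to $X$) if it has a partial computable (partial $X$-computable) dense description. A set $X$ is weakly $n$-random relative to $Z$ if $X$ lies in no $\Pi^{0,Z}_n$ class of measure $0$. An enumeration operator is a c.e. set $W$ of pairs $(F,k)$ with $F$ finite; $W^Y=\{k: \exists (F,k)\in W,\ F\subseteq Y\}$; a partial function $e$ is enumeration reducible to a partial function $d$ if $\mathrm{gra}(e)=W^{\mathrm{gra}(d)}$ for some enumeration operator $W$. $h\le_{\mathrm{nd}} g$ means every dense description $d$ of $g$ has a dense description $e$ of $h$ enumeration reducible to $d$; $h\le_{\mathrm{ud}} g$ means there is a single enumeration operator $W$ such that for every dense description $d$ of $g$, $W^{\mathrm{gra}(d)}$ is the graph of a dense description of $h$. Sets are identified with their characteristic functions. *)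

theory Defs
  imports "HOL-Probability.Probability" "HOL-Library.Nat_Bijection"
begin

text \<open>
  Partial recursive functions relative to an oracle \<^term>\<open>Z :: nat \<Rightarrow> nat\<close>. Codes carry no
  arity: each code computes a partial recursive function of every arity, and a basic function or
  recursion applied to an argument list that does not fit it is undefined.
\<close>

datatype recf =
    Zero
  | Succ
  | Proj nat
  | Query
  | Comp recf "recf list"
  | PrimRec recf recf
  | Mu recf

fun run :: "(nat \<Rightarrow> nat) \<Rightarrow> recf \<Rightarrow> nat list \<Rightarrow> nat option" where
  "run Z Zero xs = Some 0"
| "run Z Succ xs = (case xs of [x] \<Rightarrow> Some (Suc x) | _ \<Rightarrow> None)"
| "run Z (Proj i) xs = (if i < length xs then Some (xs ! i) else None)"
| "run Z Query xs = (case xs of [x] \<Rightarrow> Some (Z x) | _ \<Rightarrow> None)"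
| "run Z (Comp h gs) xs =
     (if \<forall>g\<in>set gs. run Z g xs \<noteq> None then run Z h (map (\<lambda>g. the (run Z g xs)) gs) else None)"
| "run Z (PrimRec h g) xs =
     (case xs of
        [] \<Rightarrow> None
      | n # ys \<Rightarrow>
          rec_nat (run Z h ys)
            (\<lambda>k r. case r of None \<Rightarrow> None | Some v \<Rightarrow> run Z g (k # v # ys)) n)"
| "run Z (Mu h) xs =
     (if \<exists>n. run Z h (n # xs) = Some 0 \<and> (\<forall>m<n. run Z h (m # xs) \<noteq> None)
      then Some (LEAST n. run Z h (n # xs) = Some 0) else None)"

fun oracle_free :: "recf \<Rightarrow> bool" where
  "oracle_free Zero = True"
| "oracle_free Succ = True"
| "oracle_free (Proj i) = True"
| "oracle_free Query = False"
| "oracle_free (Comp h gs) = (oracle_free h \<and> (\<forall>g\<in>set gs. oracle_free g))"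
| "oracle_free (PrimRec h g) = (oracle_free h \<and> oracle_free g)"
| "oracle_free (Mu h) = oracle_free h"

definition partial_computable_in :: "(nat \<Rightarrow> nat) \<Rightarrow> (nat \<Rightarrow> nat option) \<Rightarrow> bool" where
  "partial_computable_in Z \<phi> \<longleftrightarrow> (\<exists>c. \<forall>n. run Z c [n] = \<phi> n)"

text \<open>An oracle-free code never consults its oracle, so the choice of oracle below is immaterial.\<close>

definition partial_computable :: "(nat \<Rightarrow> nat option) \<Rightarrow> bool" where
  "partial_computable \<phi> \<longleftrightarrow> (\<exists>c. oracle_free c \<and> (\<forall>n. run (\<lambda>_. 0) c [n] = \<phi> n))"

definition ce_set :: "nat set \<Rightarrow> bool" where
  "ce_set S \<longleftrightarrow> (\<exists>\<phi>. partial_computable \<phi> \<and> S = dom \<phi>)"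

text \<open>Subsets of \<open>\<omega>\<close> are represented by their characteristic sequences \<^typ>\<open>nat \<Rightarrow> bool\<close>.\<close>

definition char_fun :: "(nat \<Rightarrow> bool) \<Rightarrow> nat \<Rightarrow> nat" where
  "char_fun X n = of_bool (X n)"

definition rho_upto :: "nat \<Rightarrow> nat set \<Rightarrow> real" where
  "rho_upto n A = real (card (A \<inter> {0..<n})) / real n"

definition has_density :: "nat set \<Rightarrow> real \<Rightarrow> bool" where
  "has_density A r \<longleftrightarrow> (\<lambda>n. rho_upto n A) \<longlonglongrightarrow> r"

definition dense_description :: "(nat \<Rightarrow> nat option) \<Rightarrow> (nat \<Rightarrow> nat) \<Rightarrow> bool" where
  "dense_description d g \<longleftrightarrow> has_density {n. d n = Some (g n)} 1"

definition densely_computable :: "(nat \<Rightarrow> nat) \<Rightarrow> bool" where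
  "densely_computable g \<longleftrightarrow> (\<exists>d. partial_computable d \<and> dense_description d g)"

definition densely_computable_in :: "(nat \<Rightarrow> bool) \<Rightarrow> (nat \<Rightarrow> nat) \<Rightarrow> bool" where
  "densely_computable_in X g \<longleftrightarrow>
     (\<exists>d. partial_computable_in (char_fun X) d \<and> dense_description d g)"

text \<open>
  Lebesgue measure on Cantor space is taken to be complete, since the classes defined through
  quantification over all dense descriptions need not be Borel.
\<close>

definition fair_coin_measure :: "(nat \<Rightarrow> bool) measure" where
  "fair_coin_measure =
     completion (PiM (UNIV :: nat set) (\<lambda>_. measure_pmf (bernoulli_pmf (1 / 2))))"

definition oracle_join :: "(nat \<Rightarrow> nat) \<Rightarrow> (nat \<Rightarrow> nat) \<Rightarrow> nat \<Rightarrow> nat" where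
  "oracle_join Y Z n = (if even n then Y (n div 2) else Z (n div 2))"

text \<open>
  \<open>pi_prefix n R\<close> and \<open>sigma_prefix n R\<close> prefix \<open>R(x\<^sub>1, \<dots>, x\<^sub>n)\<close> with \<open>n\<close> alternating number
  quantifiers, beginning with \<open>\<forall>\<close> and \<open>\<exists>\<close> respectively.
\<close>

fun pi_prefix :: "nat \<Rightarrow> (nat list \<Rightarrow> bool) \<Rightarrow> bool"
  and sigma_prefix :: "nat \<Rightarrow> (nat list \<Rightarrow> bool) \<Rightarrow> bool" where
  "pi_prefix 0 R = R []"
| "pi_prefix (Suc n) R = (\<forall>x. sigma_prefix n (\<lambda>xs. R (x # xs)))"
| "sigma_prefix 0 R = R []"
| "sigma_prefix (Suc n) R = (\<exists>x. pi_prefix n (\<lambda>xs. R (x # xs)))"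

text \<open>
  The matrix of a \<open>\<Pi>\<^sub>n\<close> class relative to \<open>Z\<close> is a relation \<open>R(x\<^sub>1, \<dots>, x\<^sub>n, X)\<close> decided by a single
  procedure, total for every \<open>X\<close>, with oracle the join of \<open>X\<close> and \<open>Z\<close>.
\<close>

definition pi_class :: "nat \<Rightarrow> (nat \<Rightarrow> nat) \<Rightarrow> (nat \<Rightarrow> bool) set \<Rightarrow> bool" where
  "pi_class n Z C \<longleftrightarrow>
     (\<exists>c. (\<forall>X xs. length xs = n \<longrightarrow> run (oracle_join (char_fun X) Z) c xs \<in> {Some 0, Some 1}) \<and>
          C = {X. pi_prefix n (\<lambda>xs. run (oracle_join (char_fun X) Z) c xs = Some 1)})"

definition weakly_random :: "nat \<Rightarrow> (nat \<Rightarrow> nat) \<Rightarrow> (nat \<Rightarrow> bool) \<Rightarrow> bool" where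
  "weakly_random n Z X \<longleftrightarrow>
     (\<forall>C. pi_class n Z C \<and> C \<in> null_sets fair_coin_measure \<longrightarrow> X \<notin> C)"

text \<open>A set of pairs \<open>(F, k)\<close> is c.e. via canonical indices of the finite sets \<open>F\<close>.\<close>

definition enumeration_operator :: "(nat set \<times> nat) set \<Rightarrow> bool" where
  "enumeration_operator W \<longleftrightarrow>
     (\<forall>(F, k)\<in>W. finite F) \<and> ce_set ((\<lambda>(F, k). prod_encode (set_encode F, k)) ` W)"

definition enum_apply :: "(nat set \<times> nat) set \<Rightarrow> nat set \<Rightarrow> nat set" where
  "enum_apply W Y = {k. \<exists>F. (F, k) \<in> W \<and> F \<subseteq> Y}"

definition gra :: "(nat \<Rightarrow> nat option) \<Rightarrow> nat set" where
  "gra d = {prod_encode (n, m) | n m. d n = Some m}"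

definition enum_reducible :: "(nat \<Rightarrow> nat option) \<Rightarrow> (nat \<Rightarrow> nat option) \<Rightarrow> bool" where
  "enum_reducible e d \<longleftrightarrow> (\<exists>W. enumeration_operator W \<and> gra e = enum_apply W (gra d))"

definition nd_reducible :: "(nat \<Rightarrow> nat) \<Rightarrow> (nat \<Rightarrow> nat) \<Rightarrow> bool" (infix "\<le>\<^sub>n\<^sub>d" 50) where
  "h \<le>\<^sub>n\<^sub>d g \<longleftrightarrow>
     (\<forall>d. dense_description d g \<longrightarrow> (\<exists>e. dense_description e h \<and> enum_reducible e d))"

definition ud_reducible :: "(nat \<Rightarrow> nat) \<Rightarrow> (nat \<Rightarrow> nat) \<Rightarrow> bool" (infix "\<le>\<^sub>u\<^sub>d" 50) where
  "h \<le>\<^sub>u\<^sub>d g \<longleftrightarrow>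
     (\<exists>W. enumeration_operator W \<and>
        (\<forall>d. dense_description d g \<longrightarrow>
           (\<exists>e. dense_description e h \<and> enum_apply W (gra d) = gra e)))"

end

theory Submission
  imports Defs
begin

text \<open>
  Fix an oracle code \<open>c\<close> and let \<open>C\<close> be the class of all \<open>X\<close> from which \<open>c\<close> computes a dense
  description of \<open>f\<close>. Suppose \<open>\<mu> C > 0\<close> and choose, by Lebesgue density, a cylinder \<open>B\<close> with
  \<open>\<mu> (C \<inter> B) > \<mu> B / 2\<close>. By dominated convergence and Markov's inequality, for a density one set of
  \<open>k\<close> more than half of \<open>B\<close> computes the value \<open>f k\<close>, so a search for the value that wins the
  majority vote inside \<open>B\<close> is an oracle-free dense description of \<open>f\<close>. Hence \<open>\<mu> C = 0\<close> if \<open>f\<close> is not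
  densely computable.
  Moreover \<open>X \<in> C\<close> says that for every \<open>\<epsilon>\<close> there is \<open>N\<close> such that for all \<open>n \<ge> N\<close> there is a
  stage at which \<open>c\<close> is correct on a fraction \<open>1 - \<epsilon>\<close> of the first \<open>n\<close> arguments, so that \<open>C\<close> is a
  \<open>\<Pi>\<^sub>4\<close> class relative to \<open>f\<close>. Finally, the characteristic function of \<open>X\<close> is a dense description
  of itself, so \<open>A \<le>\<^sub>n\<^sub>d X\<close> gives a dense description of \<open>A\<close> that is enumerable, hence computable,
  from \<open>X\<close>.
\<close>

section \<open>Uniformly computable functionals\<close>

text \<open>
  The flag \<open>q\<close> permits queries to the oracle. Decidable relations are functionals of the form
  \<open>of_bool P\<close>. A bound variable is prepended to the environment \<open>e\<close>, so that the closure rules for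
  binders can be used as introduction rules.
\<close>

definition computable :: "bool \<Rightarrow> nat \<Rightarrow> ((nat \<Rightarrow> nat) \<Rightarrow> (nat \<Rightarrow> nat) \<Rightarrow> nat) \<Rightarrow> bool" where
  "computable q a F \<longleftrightarrow>
     (\<exists>c. (q \<or> oracle_free c) \<and> (\<forall>Z e. run Z c (map e [0..<a]) = Some (F Z e)))"

lemma computableI:
  assumes "q \<or> oracle_free c" "\<And>Z e. run Z c (map e [0..<a]) = Some (F Z e)"
  shows "computable q a F"
  using assms unfolding computable_def by blast

lemma computableE:
  assumes "computable q a F"
  obtains c where "q \<or> oracle_free c" "\<And>Z xs. length xs = a \<Longrightarrow> run Z c xs = Some (F Z ((!) xs))"
proof -
  obtain c where c: "q \<or> oracle_free c" "\<And>Z e. run Z c (map e [0..<a]) = Some (F Z e)"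
    using assms unfolding computable_def by blast
  have "run Z c xs = Some (F Z ((!) xs))" if "length xs = a" for Z xs
    using c(2)[of Z "(!) xs"] by (simp add: that[symmetric] map_nth)
  with c(1) show ?thesis by (rule that)
qed

lemma computable_var: "i < a \<Longrightarrow> computable q a (\<lambda>Z e. e i)"
  by (rule computableI[where c = "Proj i"]) auto

lemma computable_compose:
  assumes F: "computable q n F" and G: "\<And>i. i < n \<Longrightarrow> computable q a (G i)"
  shows "computable q a (\<lambda>Z e. F Z (\<lambda>i. G i Z e))"
proof -
  obtain c where c: "q \<or> oracle_free c" "\<And>Z e. run Z c (map e [0..<n]) = Some (F Z e)"
    using F unfolding computable_def by blast
  have "\<forall>i\<in>{..<n}. \<exists>g. (q \<or> oracle_free g) \<and> (\<forall>Z e. run Z g (map e [0..<a]) = Some (G i Z e))"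
    using G unfolding computable_def by simp
  then obtain g where free_g: "\<And>i. i < n \<Longrightarrow> q \<or> oracle_free (g i)"
    and run_g: "\<And>i Z e. i < n \<Longrightarrow> run Z (g i) (map e [0..<a]) = Some (G i Z e)"
    by (metis bchoice lessThan_iff)
  let ?c = "Comp c (map g [0..<n])"
  have args: "map (\<lambda>x. the (run Z x (map e [0..<a]))) (map g [0..<n]) =
      map (\<lambda>i. G i Z e) [0..<n]" for Z e
    using run_g by simp
  have "run Z ?c (map e [0..<a]) = Some (F Z (\<lambda>i. G i Z e))" for Z e
    unfolding run.simps args c(2) using run_g by simp
  moreover have "q \<or> oracle_free ?c" using free_g c(1) by auto
  ultimately show ?thesis by (rule computableI[rotated])
qed

lemma computable_reindex:
  assumes "computable q n F" "\<And>i. i < n \<Longrightarrow> g i < a"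
  shows "computable q a (\<lambda>Z e. F Z (\<lambda>i. e (g i)))"
  by (rule computable_compose[OF assms(1)]) (simp add: computable_var assms(2))

lemma computable_weaken:
  assumes "computable q a F"
  shows "computable q (Suc a) (\<lambda>Z e. F Z (\<lambda>i. e (Suc i)))"
  using computable_reindex[OF assms, of Suc] by simp

lemma computable_weaken2:
  assumes "computable q a F"
  shows "computable q (Suc (Suc a)) (\<lambda>Z e. F Z (\<lambda>i. e (Suc (Suc i))))"
  using computable_reindex[OF assms, of "\<lambda>i. Suc (Suc i)"] by simp

lemma computable_weaken_bound:
  assumes "computable q (Suc a) (\<lambda>Z e. F Z (\<lambda>i. e (Suc i)) (e 0))"
  shows "computable q (Suc (Suc a)) (\<lambda>Z e. F Z (\<lambda>i. e (Suc (Suc i))) (e 0))"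
  using computable_reindex[OF assms, of "\<lambda>i. if i = 0 then 0 else Suc i"] by simp

lemma computable_bind:
  assumes "computable q (Suc a) (\<lambda>Z e. F Z (\<lambda>i. e (Suc i)) (e 0))" "computable q a G"
  shows "computable q a (\<lambda>Z e. F Z e (G Z e))"
proof -
  have "computable q a (case_nat G (\<lambda>j Z e. e j) i)" if "i < Suc a" for i
    using that assms(2) by (auto simp: computable_var split: nat.split)
  from computable_compose[OF assms(1), where G = "case_nat G (\<lambda>j Z e. e j)", OF this]
  show ?thesis by simp
qed

lemma computable_compose3:
  assumes "computable q 3 (\<lambda>Z e. f Z (e 0) (e 1) (e 2))"
    and "computable q a F" "computable q a G" "computable q a H"
  shows "computable q a (\<lambda>Z e. f Z (F Z e) (G Z e) (H Z e))"
proof -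
  have "computable q a ([F, G, H] ! i)" if "i < 3" for i
    using that assms(2-4) by (auto simp: less_Suc_eq numeral_3_eq_3)
  from computable_compose[OF assms(1), where G = "(!) [F, G, H]", OF this] show ?thesis by simp
qed

lemma computable_Suc:
  assumes "computable q a F" shows "computable q a (\<lambda>Z e. Suc (F Z e))"
proof (rule computable_bind[where F = "\<lambda>Z e. Suc"])
  show "computable q (Suc a) (\<lambda>Z e. Suc (e 0))"
    by (rule computableI[where c = "Comp Succ [Proj 0]"])
      (simp_all del: upt_Suc add: upt_conv_Cons)
qed (rule assms)

lemma computable_const: "computable q a (\<lambda>Z e. k)"
proof (induction k)
  case 0
  show ?case by (rule computableI[where c = Zero]) auto
qed (rule computable_Suc)

lemma computable_query:
  assumes "computable True a F" shows "computable True a (\<lambda>Z e. Z (F Z e))"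
proof (rule computable_bind[where F = "\<lambda>Z e. Z"])
  show "computable True (Suc a) (\<lambda>Z e. Z (e 0))"
    by (rule computableI[where c = "Comp Query [Proj 0]"])
      (simp_all del: upt_Suc add: upt_conv_Cons)
qed (rule assms)

lemma map_upt_Suc_env: "map e [0..<Suc a] = e 0 # map (\<lambda>i. e (Suc i)) [0..<a]"
  by (simp add: upt_conv_Cons map_Suc_upt[symmetric] del: upt_Suc)

lemma computable_rec:
  assumes B: "computable q a B"
    and G: "computable q (Suc (Suc a)) (\<lambda>Z e. G Z (\<lambda>i. e (Suc (Suc i))) (e 0) (e (Suc 0)))"
    and F: "computable q a F"
  shows "computable q a (\<lambda>Z e. rec_nat (B Z e) (G Z e) (F Z e))"
proof (rule computable_bind[where F = "\<lambda>Z e. rec_nat (B Z e) (G Z e)"])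
  obtain h where h: "q \<or> oracle_free h" "\<And>Z e. run Z h (map e [0..<a]) = Some (B Z e)"
    using B unfolding computable_def by blast
  obtain g where free_g: "q \<or> oracle_free g" and run_g: "\<And>Z e. run Z g (map e [0..<Suc (Suc a)]) =
      Some (G Z (\<lambda>i. e (Suc (Suc i))) (e 0) (e (Suc 0)))"
    using G unfolding computable_def by blast
  have run_step: "run Z g (k # v # map e [0..<a]) = Some (G Z e k v)" for Z k v e
    using run_g[of Z "case_nat k (case_nat v e)"] by (simp add: map_upt_Suc_env del: upt_Suc)
  have "rec_nat (Some (B Z e)) (\<lambda>k r. case r of None \<Rightarrow> None | Some v \<Rightarrow> Some (G Z e k v)) n =
     Some (rec_nat (B Z e) (G Z e) n)" for Z e n
    by (induction n) auto
  then show "computable q (Suc a) (\<lambda>Z e. rec_nat (B Z (\<lambda>i. e (Suc i))) (G Z (\<lambda>i. e (Suc i))) (e 0))"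
    using h free_g
    by (intro computableI[where c = "PrimRec h g"])
      (auto simp: map_upt_Suc_env run_step simp del: upt_Suc)
qed (rule F)

lemma computable_plus:
  assumes "computable q a F" "computable q a G"
  shows "computable q a (\<lambda>Z e. F Z e + G Z e)"
proof -
  have "rec_nat m (\<lambda>_. Suc) n = m + n" for m n by (induction n) auto
  moreover have "computable q a (\<lambda>Z e. rec_nat (F Z e) (\<lambda>_. Suc) (G Z e))"
    by (intro computable_rec computable_Suc computable_var assms) simp
  ultimately show ?thesis by simp
qed

lemma computable_mult:
  assumes "computable q a F" "computable q a G"
  shows "computable q a (\<lambda>Z e. F Z e * G Z e)"
proof -
  have "rec_nat 0 (\<lambda>_ v. v + m) n = m * n" for m n by (induction n) auto
  moreover have "computable q a (\<lambda>Z e. rec_nat 0 (\<lambda>_ v. v + F Z e) (G Z e))"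
    by (intro computable_rec computable_plus computable_var computable_const
        computable_weaken2 assms) simp
  ultimately show ?thesis by simp
qed

lemma computable_power:
  assumes "computable q a F" "computable q a G"
  shows "computable q a (\<lambda>Z e. F Z e ^ G Z e)"
proof -
  have "rec_nat 1 (\<lambda>_ v. v * m) n = m ^ n" for m n :: nat by (induction n) auto
  moreover have "computable q a (\<lambda>Z e. rec_nat 1 (\<lambda>_ v. v * F Z e) (G Z e))"
    by (intro computable_rec computable_mult computable_var computable_const
        computable_weaken2 assms) simp
  ultimately show ?thesis by simp
qed

lemma computable_minus:
  assumes "computable q a F" "computable q a G"
  shows "computable q a (\<lambda>Z e. F Z e - G Z e)"
proof -
  have "rec_nat 0 (\<lambda>k _. k) n = n - 1" for n by (cases n) auto
  moreover have "computable q b (\<lambda>Z e. rec_nat 0 (\<lambda>k _. k) (H Z e))" if "computable q b H" for b H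
    by (intro computable_rec computable_var computable_const that) simp
  ultimately have pred: "computable q b (\<lambda>Z e. H Z e - 1)" if "computable q b H" for b H
    using that by simp
  have "rec_nat m (\<lambda>_ v. v - 1) n = m - n" for m n by (induction n) auto
  moreover have "computable q a (\<lambda>Z e. rec_nat (F Z e) (\<lambda>_ v. v - 1) (G Z e))"
    by (intro computable_rec pred computable_var assms) simp
  ultimately show ?thesis by simp
qed

lemma computable_sum:
  assumes G: "computable q a G" and F: "computable q (Suc a) (\<lambda>Z e. F Z (\<lambda>i. e (Suc i)) (e 0))"
  shows "computable q a (\<lambda>Z e. \<Sum>k<G Z e. F Z e k)"
proof -
  have "rec_nat 0 (\<lambda>k v. v + h k) n = (\<Sum>k<n. h k)" for n and h :: "nat \<Rightarrow> nat"
    by (induction n) auto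
  moreover have "computable q a (\<lambda>Z e. rec_nat 0 (\<lambda>k v. v + F Z e k) (G Z e))"
    by (intro computable_rec computable_plus computable_var computable_const
        computable_weaken_bound F G) simp
  ultimately show ?thesis by simp
qed

lemma computable_not:
  assumes "computable q a (\<lambda>Z e. of_bool (P Z e))"
  shows "computable q a (\<lambda>Z e. of_bool (\<not> P Z e))"
proof -
  have "of_bool (\<not> p) = (1 - of_bool p :: nat)" for p by simp
  then show ?thesis by (simp only: computable_minus computable_const assms)
qed

lemma computable_conj:
  assumes "computable q a (\<lambda>Z e. of_bool (P Z e))" "computable q a (\<lambda>Z e. of_bool (Q Z e))"
  shows "computable q a (\<lambda>Z e. of_bool (P Z e \<and> Q Z e))"
  using computable_mult[OF assms] by (simp add: of_bool_conj)

lemma computable_disj: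
  assumes "computable q a (\<lambda>Z e. of_bool (P Z e))" "computable q a (\<lambda>Z e. of_bool (Q Z e))"
  shows "computable q a (\<lambda>Z e. of_bool (P Z e \<or> Q Z e))"
  using computable_not[OF computable_conj[OF assms[THEN computable_not]]] by simp

lemma computable_imp:
  assumes "computable q a (\<lambda>Z e. of_bool (P Z e))" "computable q a (\<lambda>Z e. of_bool (Q Z e))"
  shows "computable q a (\<lambda>Z e. of_bool (P Z e \<longrightarrow> Q Z e))"
  using computable_disj[OF computable_not[OF assms(1)] assms(2)] by (simp only: imp_conv_disj)

lemma computable_le:
  assumes "computable q a F" "computable q a G"
  shows "computable q a (\<lambda>Z e. of_bool (F Z e \<le> G Z e))"
proof -
  have "of_bool (m \<le> n) = 1 - (m - n)" for m n :: nat by auto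
  then show ?thesis by (simp only: computable_minus computable_const assms)
qed

lemma computable_less:
  assumes "computable q a F" "computable q a G"
  shows "computable q a (\<lambda>Z e. of_bool (F Z e < G Z e))"
  using computable_not[OF computable_le[OF assms(2,1)]] by (simp only: not_le)

lemma computable_eq:
  assumes "computable q a F" "computable q a G"
  shows "computable q a (\<lambda>Z e. of_bool (F Z e = G Z e))"
  using computable_conj[OF computable_le[OF assms] computable_le[OF assms(2,1)]]
  by (simp only: eq_iff)

lemma computable_ex:
  assumes "computable q a G" "computable q (Suc a) (\<lambda>Z e. of_bool (P Z (\<lambda>i. e (Suc i)) (e 0)))"
  shows "computable q a (\<lambda>Z e. of_bool (\<exists>k<G Z e. P Z e k))"
proof -
  have "0 < (\<Sum>k<n. of_bool (p k) :: nat) \<longleftrightarrow> (\<exists>k<n. p k)" for n and p :: "nat \<Rightarrow> bool"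
    by (induction n) (auto simp: less_Suc_eq)
  with computable_less[OF computable_const[where k = 0] computable_sum[OF assms]]
  show ?thesis by (simp only:)
qed

lemma computable_all:
  assumes "computable q a G" "computable q (Suc a) (\<lambda>Z e. of_bool (P Z (\<lambda>i. e (Suc i)) (e 0)))"
  shows "computable q a (\<lambda>Z e. of_bool (\<forall>k<G Z e. P Z e k))"
  using computable_not[OF computable_ex[OF assms(1) computable_not[OF assms(2)]]] by simp

lemma computable_if:
  assumes "computable q a (\<lambda>Z e. of_bool (P Z e))" "computable q a F" "computable q a G"
  shows "computable q a (\<lambda>Z e. if P Z e then F Z e else G Z e)"
proof -
  have "(if p then m else n) = of_bool p * m + of_bool (\<not> p) * n" for p and m n :: nat by auto
  then show ?thesis by (simp only: computable_plus computable_mult computable_not assms)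
qed

lemma div_eq_sum_of_bool:
  fixes m n :: nat
  assumes "n \<noteq> 0"
  shows "m div n = (\<Sum>k<m. of_bool (Suc k * n \<le> m))"
proof -
  have "{..<m} \<inter> {k. Suc k * n \<le> m} = {..<m div n}"
    using assms div_le_dividend[of m n]
    by (auto simp: less_eq_div_iff_mult_less_eq Suc_le_eq[symmetric] simp del: mult_Suc
        intro: order_less_le_trans)
  then show ?thesis by (simp del: mult_Suc)
qed

lemma computable_div:
  assumes "computable q a F" "computable q a G"
  shows "computable q a (\<lambda>Z e. F Z e div G Z e)"
proof -
  have "m div n = (if n = 0 then 0 else \<Sum>k<m. of_bool (Suc k * n \<le> m))" for m n :: nat
    using div_eq_sum_of_bool by simp
  moreover have "computable q a (\<lambda>Z e. if G Z e = 0 then 0 else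
      \<Sum>k<F Z e. of_bool (Suc k * G Z e \<le> F Z e))"
    by (intro computable_if computable_sum computable_le computable_eq computable_mult
        computable_Suc computable_var computable_const computable_weaken assms) simp
  ultimately show ?thesis by (simp only:)
qed

lemma computable_mod:
  assumes "computable q a F" "computable q a G"
  shows "computable q a (\<lambda>Z e. F Z e mod G Z e)"
  using computable_minus[OF assms(1) computable_mult[OF computable_div[OF assms] assms(2)]]
  by (simp add: minus_div_mult_eq_mod)

lemma computable_odd:
  assumes "computable q a F"
  shows "computable q a (\<lambda>Z e. of_bool (odd (F Z e)))"
  using computable_mod[OF assms computable_const[of q a 2]] by (simp add: mod_2_eq_odd)

lemma computable_bit:
  assumes "computable q a F" "computable q a G"
  shows "computable q a (\<lambda>Z e. of_bool (bit (F Z e) (G Z e)))"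
  unfolding bit_iff_odd
  by (intro computable_odd computable_div computable_power computable_const assms)

lemma computable_take_bit:
  assumes "computable q a F" "computable q a G"
  shows "computable q a (\<lambda>Z e. take_bit (F Z e) (G Z e))"
  unfolding take_bit_eq_mod by (intro computable_mod computable_power computable_const assms)

lemma computable_prod_encode:
  assumes "computable q a F" "computable q a G"
  shows "computable q a (\<lambda>Z e. prod_encode (F Z e, G Z e))"
  unfolding prod_encode_def triangle_def prod.case
  by (intro computable_plus computable_div computable_mult computable_Suc computable_const assms)

lemmas computable_intros =
  computable_var computable_const computable_Suc computable_plus computable_minus computable_mult
  computable_power computable_take_bit computable_prod_encode computable_sum computable_if
  computable_not computable_conj computable_imp computable_le computable_less computable_eq
  computable_bit computable_ex computable_all

lemma minimisation_code:
  assumes "computable q 2 (\<lambda>Z e. of_bool (P Z (e 0) (e 1)))"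
  obtains c where "q \<or> oracle_free c"
    "\<And>Z n. run Z c [n] = (if \<exists>s. P Z n s then Some (LEAST s. P Z n s) else None)"
proof -
  have "computable q 2 (\<lambda>Z e. of_bool (\<not> P Z (e 1) (e 0)))"
    using computable_reindex[OF computable_not[OF assms], of "\<lambda>i. if i = 0 then 1 else 0" 2] by simp
  then obtain h where "q \<or> oracle_free h"
    and run_h: "\<And>Z xs. length xs = 2 \<Longrightarrow> run Z h xs = Some (of_bool (\<not> P Z (xs ! 1) (xs ! 0)))"
    by (rule computableE) blast
  then show ?thesis by (intro that[of "Mu h"]) auto
qed

lemma sum_mult_of_bool_unique:
  fixes m n :: nat
  assumes "m < n" "\<And>i. p i \<longleftrightarrow> i = m"
  shows "(\<Sum>i<n. i * of_bool (p i)) = m"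
proof -
  have "(\<Sum>i<n. i * of_bool (p i)) = (\<Sum>i<n. if i = m then i else 0)"
    using assms(2) by (intro sum.cong) auto
  with assms(1) show ?thesis by simp
qed

text \<open>The code searches for the least \<open>s\<close> that bounds a value \<open>m\<close> together with its witness \<open>t\<close>.\<close>

lemma semidecidable_graph_code:
  assumes P: "computable q 3 (\<lambda>Z e. of_bool (P Z (e 0) (e 1) (e 2)))"
  obtains c where "q \<or> oracle_free c"
    "\<And>Z k m. (\<And>m m' t t'. \<lbrakk>P Z k m t; P Z k m' t'\<rbrakk> \<Longrightarrow> m = m') \<Longrightarrow>
      run Z c [k] = Some m \<longleftrightarrow> (\<exists>t. P Z k m t)"
proof -
  note closed_P = computable_compose3[where f = "\<lambda>Z k m t. of_bool (P Z k m t)", OF P]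
  define found where "found Z k s \<longleftrightarrow> (\<exists>m<s. \<exists>t<s. P Z k m t)" for Z k s
  have "computable q 2 (\<lambda>Z e. of_bool (found Z (e 0) (e 1)))"
    unfolding found_def by (intro computable_intros closed_P) auto
  then obtain h where free_h: "q \<or> oracle_free h"
    and run_h: "\<And>Z k. run Z h [k] = (if \<exists>s. found Z k s then Some (LEAST s. found Z k s) else None)"
    by (rule minimisation_code) blast
  have "computable q 2 (\<lambda>Z e. \<Sum>m<e 0. m * of_bool (\<exists>t<e 0. P Z (e 1) m t))"
    by (intro computable_intros closed_P) auto
  then obtain v where free_v: "q \<or> oracle_free v"
    and run_v: "\<And>Z s k. run Z v [s, k] = Some (\<Sum>m<s. m * of_bool (\<exists>t<s. P Z k m t))"
    by (rule computableE) force
  show ?thesis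
  proof (rule that[of "Comp v [h, Proj 0]"])
    show "q \<or> oracle_free (Comp v [h, Proj 0])" using free_h free_v by auto
  next
    fix Z k m
    assume single_valued: "\<And>m m' t t'. \<lbrakk>P Z k m t; P Z k m' t'\<rbrakk> \<Longrightarrow> m = m'"
    show "run Z (Comp v [h, Proj 0]) [k] = Some m \<longleftrightarrow> (\<exists>t. P Z k m t)"
    proof (cases "\<exists>s. found Z k s")
      case True
      define s where "s = (LEAST s. found Z k s)"
      have "found Z k s" unfolding s_def using True by (rule LeastI_ex)
      then obtain m' t' where m': "m' < s" "t' < s" "P Z k m' t'" unfolding found_def by blast
      then have "(\<exists>t<s. P Z k i t) \<longleftrightarrow> i = m'" for i
        using single_valued by blast
      then have "run Z v [s, k] = Some m'"
        unfolding run_v using m'(1) by (simp add: sum_mult_of_bool_unique)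
      then have "run Z (Comp v [h, Proj 0]) [k] = Some m'" using True by (simp add: run_h s_def)
      then show ?thesis using single_valued m'(3) by auto
    next
      case False
      have "found Z k (Suc (max m t))" if "P Z k m t" for t
        unfolding found_def using that by (meson le_imp_less_Suc max.cobounded1 max.cobounded2)
      then show ?thesis using False by (auto simp: run_h)
    qed
  qed
qed

section \<open>Step-bounded evaluation\<close>

text \<open>The value \<open>0\<close> stands for \<^const>\<open>None\<close> and \<open>Suc v\<close> for \<^term>\<open>Some v\<close>.\<close>

fun bounded_run :: "(nat \<Rightarrow> nat) \<Rightarrow> nat \<Rightarrow> recf \<Rightarrow> nat list \<Rightarrow> nat" where
  "bounded_run Z s Zero xs = 1"
| "bounded_run Z s Succ xs = (case xs of [x] \<Rightarrow> Suc (Suc x) | _ \<Rightarrow> 0)"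
| "bounded_run Z s (Proj i) xs = (if i < length xs then Suc (xs ! i) else 0)"
| "bounded_run Z s Query xs = (case xs of [x] \<Rightarrow> if x < s then Suc (Z x) else 0 | _ \<Rightarrow> 0)"
| "bounded_run Z s (Comp h gs) xs =
     (if \<forall>g\<in>set gs. bounded_run Z s g xs \<noteq> 0
      then bounded_run Z s h (map (\<lambda>g. bounded_run Z s g xs - 1) gs) else 0)"
| "bounded_run Z s (PrimRec h g) xs =
     (case xs of
        [] \<Rightarrow> 0
      | n # ys \<Rightarrow>
          rec_nat (bounded_run Z s h ys)
            (\<lambda>k r. if r = 0 then 0 else bounded_run Z s g (k # (r - 1) # ys)) n)"
| "bounded_run Z s (Mu h) xs =
     (\<Sum>n<s. if bounded_run Z s h (n # xs) = 1 \<and> (\<forall>m<n. 1 < bounded_run Z s h (m # xs))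
       then Suc n else 0)"

lemma bounded_run_cong:
  assumes "\<And>x. x < s \<Longrightarrow> Z x = Z' x"
  shows "bounded_run Z s c xs = bounded_run Z' s c xs"
proof (induction c arbitrary: xs)
  case Query
  show ?case using assms by (auto split: list.splits)
next
  case (Comp h gs)
  have args: "map (\<lambda>g. bounded_run Z s g xs - 1) gs = map (\<lambda>g. bounded_run Z' s g xs - 1) gs"
    using Comp.IH(2) by simp
  show ?case unfolding bounded_run.simps Comp.IH(1) args using Comp.IH(2) by simp
next
  case (PrimRec h g)
  show ?case unfolding bounded_run.simps PrimRec.IH ..
qed auto

lemma run_Comp_eq_Some_iff:
  "run Z (Comp h gs) xs = Some v \<longleftrightarrow>
     (\<exists>ys. list_all2 (\<lambda>g y. run Z g xs = Some y) gs ys \<and> run Z h ys = Some v)"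
proof -
  have "list_all2 (\<lambda>g y. run Z g xs = Some y) gs ys \<longleftrightarrow>
      (\<forall>g\<in>set gs. run Z g xs \<noteq> None) \<and> ys = map (\<lambda>g. the (run Z g xs)) gs" for ys
    by (induction gs arbitrary: ys) (auto simp: list_all2_Cons1)
  then show ?thesis by auto
qed

lemma bounded_run_Comp_eq_Suc_iff:
  "bounded_run Z s (Comp h gs) xs = Suc v \<longleftrightarrow>
     (\<exists>ys. list_all2 (\<lambda>g y. bounded_run Z s g xs = Suc y) gs ys \<and> bounded_run Z s h ys = Suc v)"
proof -
  have "list_all2 (\<lambda>g y. bounded_run Z s g xs = Suc y) gs ys \<longleftrightarrow>
      (\<forall>g\<in>set gs. bounded_run Z s g xs \<noteq> 0) \<and> ys = map (\<lambda>g. bounded_run Z s g xs - 1) gs" for ys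
    by (induction gs arbitrary: ys) (auto simp: list_all2_Cons1 gr0_conv_Suc)
  then show ?thesis by auto
qed

lemma run_PrimRec_eq_Some_iff:
  "run Z (PrimRec h g) (n # ys) = Some v \<longleftrightarrow>
     (\<exists>r. run Z h ys = Some (r 0) \<and>
        (\<forall>k<n. run Z g (k # r k # ys) = Some (r (Suc k))) \<and> r n = v)"
proof (induction n arbitrary: v)
  case 0
  show ?case by auto
next
  case (Suc n)
  have "run Z (PrimRec h g) (Suc n # ys) = Some v \<longleftrightarrow>
      (\<exists>w. run Z (PrimRec h g) (n # ys) = Some w \<and> run Z g (n # w # ys) = Some v)"
    by (auto split: option.splits)
  also have "\<dots> \<longleftrightarrow> (\<exists>r. run Z h ys = Some (r 0) \<and>
      (\<forall>k<Suc n. run Z g (k # r k # ys) = Some (r (Suc k))) \<and> r (Suc n) = v)"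
    (is "?step \<longleftrightarrow> ?trace")
  proof
    assume ?step
    then obtain r where "run Z h ys = Some (r 0)" "\<forall>k<n. run Z g (k # r k # ys) = Some (r (Suc k))"
      "run Z g (n # r n # ys) = Some v"
      unfolding Suc.IH by blast
    then show ?trace by (intro exI[of _ "r(Suc n := v)"]) (auto simp: less_Suc_eq)
  next
    assume ?trace
    then show ?step unfolding Suc.IH by (metis lessI less_SucI)
  qed
  finally show ?case .
qed

lemma bounded_run_PrimRec_eq_Suc_iff:
  "bounded_run Z s (PrimRec h g) (n # ys) = Suc v \<longleftrightarrow>
     (\<exists>r. bounded_run Z s h ys = Suc (r 0) \<and>
        (\<forall>k<n. bounded_run Z s g (k # r k # ys) = Suc (r (Suc k))) \<and> r n = v)"
proof (induction n arbitrary: v)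
  case 0
  show ?case by auto
next
  case (Suc n)
  have "bounded_run Z s (PrimRec h g) (Suc n # ys) = Suc v \<longleftrightarrow>
      (\<exists>w. bounded_run Z s (PrimRec h g) (n # ys) = Suc w \<and> bounded_run Z s g (n # w # ys) = Suc v)"
    by (auto simp: gr0_conv_Suc)
  also have "\<dots> \<longleftrightarrow> (\<exists>r. bounded_run Z s h ys = Suc (r 0) \<and>
      (\<forall>k<Suc n. bounded_run Z s g (k # r k # ys) = Suc (r (Suc k))) \<and> r (Suc n) = v)"
    (is "?step \<longleftrightarrow> ?trace")
  proof
    assume ?step
    then obtain r where "bounded_run Z s h ys = Suc (r 0)"
      "\<forall>k<n. bounded_run Z s g (k # r k # ys) = Suc (r (Suc k))"
      "bounded_run Z s g (n # r n # ys) = Suc v"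
      unfolding Suc.IH by blast
    then show ?trace by (intro exI[of _ "r(Suc n := v)"]) (auto simp: less_Suc_eq)
  next
    assume ?trace
    then show ?step unfolding Suc.IH by (metis lessI less_SucI)
  qed
  finally show ?case .
qed

lemma run_Mu_eq_Some_iff:
  "run Z (Mu h) xs = Some v \<longleftrightarrow>
     run Z h (v # xs) = Some 0 \<and> (\<forall>m<v. \<exists>w. run Z h (m # xs) = Some (Suc w))"
proof
  assume "run Z (Mu h) xs = Some v"
  then obtain n where n: "run Z h (n # xs) = Some 0" "\<forall>m<n. run Z h (m # xs) \<noteq> None"
    and v: "v = (LEAST n. run Z h (n # xs) = Some 0)"
    by (auto split: if_splits)
  have "run Z h (v # xs) = Some 0" unfolding v by (rule LeastI) (rule n(1))
  moreover have "\<exists>w. run Z h (m # xs) = Some (Suc w)" if "m < v" for m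
  proof -
    have "v \<le> n" unfolding v by (rule Least_le) (rule n(1))
    with that n(2) have "run Z h (m # xs) \<noteq> None" by simp
    moreover have "run Z h (m # xs) \<noteq> Some 0" using that unfolding v by (rule not_less_Least)
    ultimately show ?thesis by (metis not0_implies_Suc not_None_eq)
  qed
  ultimately show "run Z h (v # xs) = Some 0 \<and> (\<forall>m<v. \<exists>w. run Z h (m # xs) = Some (Suc w))"
    by blast
next
  assume v: "run Z h (v # xs) = Some 0 \<and> (\<forall>m<v. \<exists>w. run Z h (m # xs) = Some (Suc w))"
  then have "v \<le> k" if "run Z h (k # xs) = Some 0" for k
    using that by (cases "k < v") auto
  with v have "(LEAST n. run Z h (n # xs) = Some 0) = v" by (intro Least_equality) auto
  with v show "run Z (Mu h) xs = Some v" by fastforce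
qed

lemma bounded_run_Mu_eq_Suc_iff:
  "bounded_run Z s (Mu h) xs = Suc v \<longleftrightarrow>
     v < s \<and> bounded_run Z s h (v # xs) = 1 \<and> (\<forall>m<v. \<exists>w. bounded_run Z s h (m # xs) = Suc (Suc w))"
proof -
  define first where
    "first n \<longleftrightarrow> bounded_run Z s h (n # xs) = 1 \<and> (\<forall>m<n. 1 < bounded_run Z s h (m # xs))" for n
  have unique: "m = n" if "first m" "first n" for m n
    using that unfolding first_def by (cases m n rule: linorder_cases) force+
  have "(\<Sum>n<s. if first n then Suc n else 0) = Suc v \<longleftrightarrow> v < s \<and> first v"
  proof (cases "\<exists>n<s. first n")
    case True
    then obtain n where n: "n < s" "first n" by blast
    then have "first k \<longleftrightarrow> k = n" for k using unique by blast
    then show ?thesis using n(1) by auto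
  next
    case False
    then have "(\<Sum>n<s. if first n then Suc n else 0) = 0" by (intro sum.neutral) auto
    then show ?thesis using False by auto
  qed
  moreover have "1 < r \<longleftrightarrow> (\<exists>w. r = Suc (Suc w))" for r
    by (simp add: less_iff_Suc_add)
  ultimately show ?thesis unfolding first_def by simp
qed

lemma bounded_run_mono:
  assumes "s \<le> s'" "bounded_run Z s c xs = Suc v"
  shows "bounded_run Z s' c xs = Suc v"
  using assms(2)
proof (induction c arbitrary: xs v)
  case Query
  then show ?case using assms(1) by (auto split: list.splits if_splits)
next
  case (Comp h gs)
  then show ?case
    unfolding bounded_run_Comp_eq_Suc_iff by (blast intro: list.rel_mono_strong)
next
  case (PrimRec h g)
  then obtain n ys where xs: "xs = n # ys" by (auto split: list.splits)
  show ?case using PrimRec unfolding xs bounded_run_PrimRec_eq_Suc_iff by blast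
next
  case (Mu h)
  then show ?case
    using assms(1) unfolding bounded_run_Mu_eq_Suc_iff One_nat_def by (metis order_less_le_trans)
qed auto

lemma bounded_run_sound: "bounded_run Z s c xs = Suc v \<Longrightarrow> run Z c xs = Some v"
proof (induction c arbitrary: xs v)
  case (Comp h gs)
  then show ?case
    unfolding bounded_run_Comp_eq_Suc_iff run_Comp_eq_Some_iff
    by (blast intro: list.rel_mono_strong)
next
  case (PrimRec h g)
  then obtain n ys where xs: "xs = n # ys" by (auto split: list.splits)
  show ?case
    using PrimRec unfolding xs bounded_run_PrimRec_eq_Suc_iff run_PrimRec_eq_Some_iff by blast
next
  case (Mu h)
  then show ?case unfolding bounded_run_Mu_eq_Suc_iff run_Mu_eq_Some_iff One_nat_def by blast
qed (auto split: list.splits if_splits)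

lemma eventually_list_all2:
  assumes "list_all2 (\<lambda>x y. \<forall>\<^sub>F s in F. P s x y) xs ys"
  shows "\<forall>\<^sub>F s in F. list_all2 (P s) xs ys"
  using assms by (induction rule: list_all2_induct) (auto elim: eventually_elim2)

lemma eventually_all_less:
  fixes n :: nat
  assumes "\<And>k. k < n \<Longrightarrow> \<forall>\<^sub>F s in F. P s k"
  shows "\<forall>\<^sub>F s in F. \<forall>k<n. P s k"
  using eventually_ball_finite[of "{..<n}" P F] assms by (simp add: Ball_def)

lemma eventually_bounded_run:
  "run Z c xs = Some v \<Longrightarrow> \<forall>\<^sub>F s in sequentially. bounded_run Z s c xs = Suc v"
proof (induction c arbitrary: xs v)
  case Query
  then show ?case
    by (auto split: list.splits intro: eventually_mono[OF eventually_gt_at_top])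
next
  case (Comp h gs)
  then obtain ys where ys: "list_all2 (\<lambda>g y. run Z g xs = Some y) gs ys" "run Z h ys = Some v"
    unfolding run_Comp_eq_Some_iff by blast
  have "list_all2 (\<lambda>g y. \<forall>\<^sub>F s in sequentially. bounded_run Z s g xs = Suc y) gs ys"
    using ys(1) by (rule list.rel_mono_strong) (rule Comp.IH(2))
  from eventually_list_all2[OF this] Comp.IH(1)[OF ys(2)] show ?case
    by eventually_elim (auto simp only: bounded_run_Comp_eq_Suc_iff)
next
  case (PrimRec h g)
  then obtain n ys where xs: "xs = n # ys" by (auto split: list.splits)
  obtain r where r: "run Z h ys = Some (r 0)"
      "\<And>k. k < n \<Longrightarrow> run Z g (k # r k # ys) = Some (r (Suc k))" "r n = v"
    using PrimRec.prems unfolding xs run_PrimRec_eq_Some_iff by blast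
  have "\<forall>\<^sub>F s in sequentially. \<forall>k<n. bounded_run Z s g (k # r k # ys) = Suc (r (Suc k))"
    by (intro eventually_all_less PrimRec.IH(2) r(2))
  with PrimRec.IH(1)[OF r(1)] show ?case
  proof eventually_elim
    case (elim s)
    with r(3) show ?case unfolding xs bounded_run_PrimRec_eq_Suc_iff by blast
  qed
next
  case (Mu h)
  then have v: "run Z h (v # xs) = Some 0" "\<And>m. m < v \<Longrightarrow> \<exists>w. run Z h (m # xs) = Some (Suc w)"
    unfolding run_Mu_eq_Some_iff by auto
  have "\<forall>\<^sub>F s in sequentially. \<forall>m<v. \<exists>w. bounded_run Z s h (m # xs) = Suc (Suc w)"
  proof (rule eventually_all_less)
    fix m assume "m < v"
    then obtain w where "run Z h (m # xs) = Some (Suc w)" using v(2) by blast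
    from Mu.IH[OF this] show "\<forall>\<^sub>F s in sequentially. \<exists>w. bounded_run Z s h (m # xs) = Suc (Suc w)"
      by eventually_elim blast
  qed
  with Mu.IH[OF v(1)] eventually_gt_at_top[of v] show ?case
    by eventually_elim (auto simp only: bounded_run_Mu_eq_Suc_iff One_nat_def)
qed (auto split: list.splits if_splits)

lemma run_eq_Some_iff: "run Z c xs = Some v \<longleftrightarrow> (\<exists>s. bounded_run Z s c xs = Suc v)"
  using eventually_bounded_run[of Z c xs v] bounded_run_sound
  by (auto simp: eventually_sequentially)

lemma computable_ball_list:
  assumes "\<And>x. x \<in> set xs \<Longrightarrow> computable q a (\<lambda>Z e. of_bool (P Z e x))"
  shows "computable q a (\<lambda>Z e. of_bool (\<forall>x\<in>set xs. P Z e x))"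
  using assms
proof (induction xs)
  case Nil
  show ?case using computable_const[of q a 1] by simp
next
  case (Cons x xs)
  then have "computable q a (\<lambda>Z e. of_bool (P Z e x \<and> (\<forall>x\<in>set xs. P Z e x)))"
    by (intro computable_conj) auto
  then show ?case by simp
qed

definition bounded_run_computable :: "bool \<Rightarrow> recf \<Rightarrow> bool" where
  "bounded_run_computable q c \<longleftrightarrow>
     (\<forall>a Q S Xs. computable q (Suc a) (\<lambda>Z e. Q Z (\<lambda>i. e (Suc i)) (e 0)) \<longrightarrow> computable q a S \<longrightarrow>
        (\<forall>X\<in>set Xs. computable q a X) \<longrightarrow>
        computable q a (\<lambda>Z e. bounded_run (Q Z e) (S Z e) c (map (\<lambda>X. X Z e) Xs)))"

lemma bounded_run_computableI:
  assumes "\<And>a Q S Xs. \<lbrakk>computable q (Suc a) (\<lambda>Z e. Q Z (\<lambda>i. e (Suc i)) (e 0)); computable q a S;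
      \<And>X. X \<in> set Xs \<Longrightarrow> computable q a X\<rbrakk> \<Longrightarrow>
      computable q a (\<lambda>Z e. bounded_run (Q Z e) (S Z e) c (map (\<lambda>X. X Z e) Xs))"
  shows "bounded_run_computable q c"
  using assms unfolding bounded_run_computable_def by blast

lemma bounded_run_computableD:
  assumes "bounded_run_computable q c"
    and "computable q (Suc a) (\<lambda>Z e. Q Z (\<lambda>i. e (Suc i)) (e 0))" "computable q a S"
    and "\<And>X. X \<in> set Xs \<Longrightarrow> computable q a X"
  shows "computable q a (\<lambda>Z e. bounded_run (Q Z e) (S Z e) c (map (\<lambda>X. X Z e) Xs))"
  using assms unfolding bounded_run_computable_def by blast

lemma bounded_run_computable_Query: "bounded_run_computable q Query"
proof (rule bounded_run_computableI)
  fix a Q S Xs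
  assume Q: "computable q (Suc a) (\<lambda>Z e. Q Z (\<lambda>i. e (Suc i)) (e 0))" and S: "computable q a S"
    and Xs: "\<And>X. X \<in> set Xs \<Longrightarrow> computable q a X"
  show "computable q a (\<lambda>Z e. bounded_run (Q Z e) (S Z e) Query (map (\<lambda>X. X Z e) Xs))"
  proof (cases Xs rule: remdups_adj.cases)
    case (2 X)
    with Xs have X: "computable q a X" by simp
    have "computable q a (\<lambda>Z e. if X Z e < S Z e then Suc (Q Z e (X Z e)) else 0)"
      by (intro computable_if computable_less computable_Suc computable_bind[where F = Q]
          computable_const Q S X)
    with 2 show ?thesis by simp
  qed (simp_all add: computable_const)
qed

lemma bounded_run_computable_Comp:
  assumes h: "bounded_run_computable q h"
    and gs: "\<And>g. g \<in> set gs \<Longrightarrow> bounded_run_computable q g"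
  shows "bounded_run_computable q (Comp h gs)"
proof (rule bounded_run_computableI)
  fix a Q S Xs
  assume Q: "computable q (Suc a) (\<lambda>Z e. Q Z (\<lambda>i. e (Suc i)) (e 0))" and S: "computable q a S"
    and Xs: "\<And>X. X \<in> set Xs \<Longrightarrow> computable q a X"
  let ?G = "\<lambda>g Z e. bounded_run (Q Z e) (S Z e) g (map (\<lambda>X. X Z e) Xs)"
  have args: "computable q a (?G g)" if "g \<in> set gs" for g
    by (rule bounded_run_computableD[OF gs[OF that] Q S Xs])
  have "computable q a (\<lambda>Z e. bounded_run (Q Z e) (S Z e) h
      (map (\<lambda>X. X Z e) (map (\<lambda>g Z e. ?G g Z e - 1) gs)))"
    by (rule bounded_run_computableD[OF h Q S]) (auto intro: computable_minus computable_const args)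
  then have "computable q a (\<lambda>Z e. bounded_run (Q Z e) (S Z e) h (map (\<lambda>g. ?G g Z e - 1) gs))"
    by (simp add: comp_def)
  then show "computable q a (\<lambda>Z e. ?G (Comp h gs) Z e)"
    unfolding bounded_run.simps
    by (intro computable_if computable_ball_list computable_not computable_eq computable_const args)
qed

lemma bounded_run_computable_PrimRec:
  assumes h: "bounded_run_computable q h" and g: "bounded_run_computable q g"
  shows "bounded_run_computable q (PrimRec h g)"
proof (rule bounded_run_computableI)
  fix a Q S Xs
  assume Q: "computable q (Suc a) (\<lambda>Z e. Q Z (\<lambda>i. e (Suc i)) (e 0))" and S: "computable q a S"
    and Xs: "\<And>X. X \<in> set Xs \<Longrightarrow> computable q a X"
  show "computable q a (\<lambda>Z e. bounded_run (Q Z e) (S Z e) (PrimRec h g) (map (\<lambda>X. X Z e) Xs))"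
  proof (cases Xs)
    case Nil
    then show ?thesis by (simp add: computable_const)
  next
    case (Cons X Ys)
    let ?shift = "\<lambda>Y Z e. Y Z (\<lambda>i. e (Suc (Suc i)))"
    let ?Ys = "(\<lambda>Z e. e 0) # (\<lambda>Z e. e (Suc 0) - 1) # map ?shift Ys"
    have Q_shift: "computable q (Suc (Suc (Suc a))) (\<lambda>Z e. Q Z (\<lambda>i. e (Suc (Suc (Suc i)))) (e 0))"
      using computable_reindex[OF Q, of "\<lambda>i. if i = 0 then 0 else Suc (Suc i)"] by simp
    have "computable q (Suc (Suc a)) Y" if "Y \<in> set ?Ys" for Y
      using that computable_weaken2[OF Xs] Cons
      by (auto simp: computable_minus computable_const computable_var)
    then have "computable q (Suc (Suc a))
        (\<lambda>Z e. bounded_run (?shift Q Z e) (?shift S Z e) g (map (\<lambda>Y. Y Z e) ?Ys))"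
      by (rule bounded_run_computableD[OF g Q_shift computable_weaken2[OF S]])
    then have "computable q (Suc (Suc a)) (\<lambda>Z e. if e (Suc 0) = 0 then 0 else
        bounded_run (?shift Q Z e) (?shift S Z e) g
          (e 0 # (e (Suc 0) - 1) # map (\<lambda>Y. ?shift Y Z e) Ys))"
      by (intro computable_if computable_eq computable_var computable_const) (auto simp: comp_def)
    moreover have "computable q a (\<lambda>Z e. bounded_run (Q Z e) (S Z e) h (map (\<lambda>Y. Y Z e) Ys))"
      by (rule bounded_run_computableD[OF h Q S Xs]) (simp add: Cons)
    ultimately show ?thesis
      using Xs[of X] Cons by (simp add: computable_rec)
  qed
qed

lemma bounded_run_computable_Mu:
  assumes h: "bounded_run_computable q h"
  shows "bounded_run_computable q (Mu h)"
proof (rule bounded_run_computableI)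
  fix a Q S Xs
  assume Q: "computable q (Suc a) (\<lambda>Z e. Q Z (\<lambda>i. e (Suc i)) (e 0))" and S: "computable q a S"
    and Xs: "\<And>X. X \<in> set Xs \<Longrightarrow> computable q a X"
  let ?shift = "\<lambda>Y Z e. Y Z (\<lambda>i. e (Suc i))"
  have "computable q (Suc a) Y" if "Y \<in> set ((\<lambda>Z e. e 0) # map ?shift Xs)" for Y
    using that computable_weaken[OF Xs] by (auto simp: computable_var)
  then have "computable q (Suc a) (\<lambda>Z e. bounded_run (?shift Q Z e) (?shift S Z e) h
      (map (\<lambda>Y. Y Z e) ((\<lambda>Z e. e 0) # map ?shift Xs)))"
    by (rule bounded_run_computableD[OF h computable_weaken_bound[OF Q] computable_weaken[OF S]])
  then have step: "computable q (Suc a) (\<lambda>Z e. bounded_run (?shift Q Z e) (?shift S Z e) h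
      (e 0 # map (\<lambda>Y. ?shift Y Z e) Xs))"
    by (simp add: comp_def)
  show "computable q a (\<lambda>Z e. bounded_run (Q Z e) (S Z e) (Mu h) (map (\<lambda>X. X Z e) Xs))"
    unfolding bounded_run.simps
    by (intro computable_sum computable_if computable_conj computable_eq computable_all
        computable_less computable_Suc computable_const computable_var S step
        computable_weaken_bound[OF step]) auto
qed

lemma bounded_run_computable: "bounded_run_computable q c"
proof (induction c)
  case Zero
  show ?case
    using computable_const[of q _ 1] by (intro bounded_run_computableI) simp
next
  case Succ
  show ?case
  proof (rule bounded_run_computableI)
    fix a Q S Xs
    assume "\<And>X. X \<in> set Xs \<Longrightarrow> computable q a X"
    then show "computable q a (\<lambda>Z e. bounded_run (Q Z e) (S Z e) Succ (map (\<lambda>X. X Z e) Xs))"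
      by (cases Xs rule: remdups_adj.cases) (simp_all add: computable_Suc computable_const)
  qed
next
  case (Proj i)
  show ?case
  proof (rule bounded_run_computableI)
    fix a Q S Xs
    assume "\<And>X. X \<in> set Xs \<Longrightarrow> computable q a X"
    then show "computable q a (\<lambda>Z e. bounded_run (Q Z e) (S Z e) (Proj i) (map (\<lambda>X. X Z e) Xs))"
      by (cases "i < length Xs") (simp_all add: computable_Suc computable_const)
  qed
qed (simp_all add: bounded_run_computable_Query bounded_run_computable_Comp
      bounded_run_computable_PrimRec bounded_run_computable_Mu)

lemma computable_bounded_run:
  assumes "computable q (Suc a) (\<lambda>Z e. Q Z (\<lambda>i. e (Suc i)) (e 0))"
    and "computable q a S" "computable q a X"
  shows "computable q a (\<lambda>Z e. bounded_run (Q Z e) (S Z e) c [X Z e])"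
  using bounded_run_computableD[OF bounded_run_computable assms(1,2), of "[X]"] assms(3) by simp

section \<open>Sets of density one\<close>

lemma rho_upto_le_1: "rho_upto n A \<le> 1"
proof -
  have "card (A \<inter> {0..<n}) \<le> card {0..<n}" by (intro card_mono) auto
  then show ?thesis by (simp add: rho_upto_def divide_le_eq)
qed

lemma rho_upto_nonneg: "0 \<le> rho_upto n A"
  by (simp add: rho_upto_def)

lemma one_minus_rho_upto:
  assumes "0 < n"
  shows "1 - rho_upto n A = card ({..<n} - A) / n"
proof -
  have "real n = card (A \<inter> {0..<n}) + card ({..<n} - A)"
    using sum.Int_Diff[of "{..<n}" "\<lambda>_. 1 :: real" A] by (simp add: lessThan_atLeast0 Int_commute)
  with assms show ?thesis by (simp add: rho_upto_def field_simps)
qed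

lemma has_density_1_iff:
  "has_density A 1 \<longleftrightarrow> (\<forall>e. \<exists>N. \<forall>n\<ge>N. Suc e * card ({..<n} - A) \<le> n)"
proof -
  have "(rho_upto n A \<ge> 1 - 1 / Suc e) \<longleftrightarrow> Suc e * card ({..<n} - A) \<le> n" if "0 < n" for n e
  proof -
    have "rho_upto n A \<ge> 1 - 1 / Suc e \<longleftrightarrow> card ({..<n} - A) / real n \<le> 1 / Suc e"
      using one_minus_rho_upto[OF that, of A] by linarith
    also have "\<dots> \<longleftrightarrow> real (Suc e * card ({..<n} - A)) \<le> real n"
      using that by (simp add: field_simps)
    finally show ?thesis by (simp only: of_nat_le_iff)
  qed
  then have "(\<forall>\<^sub>F n in sequentially. rho_upto n A \<ge> 1 - 1 / Suc e) \<longleftrightarrow>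
      (\<forall>\<^sub>F n in sequentially. Suc e * card ({..<n} - A) \<le> n)" for e
    by (intro eventually_cong[OF eventually_gt_at_top[of 0]])
  moreover have "has_density A 1 \<longleftrightarrow> (\<forall>e. \<forall>\<^sub>F n in sequentially. rho_upto n A \<ge> 1 - 1 / Suc e)"
  proof
    assume "has_density A 1"
    then have "\<forall>\<^sub>F n in sequentially. 1 - 1 / Suc e < rho_upto n A" for e
      unfolding has_density_def by (rule order_tendstoD) simp
    then show "\<forall>e. \<forall>\<^sub>F n in sequentially. rho_upto n A \<ge> 1 - 1 / Suc e"
      by (blast intro: eventually_mono less_imp_le)
  next
    assume close: "\<forall>e. \<forall>\<^sub>F n in sequentially. rho_upto n A \<ge> 1 - 1 / Suc e"
    show "has_density A 1" unfolding has_density_def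
    proof (rule tendstoI)
      fix r :: real assume "0 < r"
      then obtain e where e: "1 / Suc e < r" using nat_approx_posE by blast
      from close have "\<forall>\<^sub>F n in sequentially. rho_upto n A \<ge> 1 - 1 / Suc e" ..
      then show "\<forall>\<^sub>F n in sequentially. dist (rho_upto n A) 1 < r"
      proof eventually_elim
        case (elim n)
        then show ?case using e rho_upto_le_1[of n A] unfolding dist_real_def by linarith
      qed
    qed
  qed
  ultimately show ?thesis by (simp only: eventually_sequentially)
qed

lemma has_density_1_mono:
  assumes "has_density A 1" "A \<subseteq> B" shows "has_density B 1"
proof -
  have "card ({..<n} - B) \<le> card ({..<n} - A)" for n
    using assms(2) by (intro card_mono) auto
  then show ?thesis
    using assms(1) unfolding has_density_1_iff by (meson mult_le_mono2 order_trans)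
qed

lemma has_density_UNIV: "has_density UNIV 1"
  unfolding has_density_1_iff by simp

text \<open>Markov's inequality for the uniform distribution on the first \<open>n\<close> indices, in the limit.\<close>

lemma has_density_1_if_mean_tendsto_upper_bound:
  fixes x :: "nat \<Rightarrow> real"
  assumes upper: "\<And>k. x k \<le> L" and mean: "(\<lambda>n. (\<Sum>k<n. x k) / n) \<longlonglongrightarrow> L" and "r < L"
  shows "has_density {k. r < x k} 1"
  unfolding has_density_def
proof (rule tendsto_sandwich)
  let ?G = "{k. r < x k}"
  have "1 - (L - (\<Sum>k<n. x k) / n) / (L - r) \<le> rho_upto n ?G" if "0 < n" for n
  proof -
    have "(\<Sum>k<n. (L - r) * of_bool (k \<notin> ?G)) \<le> (\<Sum>k<n. L - x k)"
      using upper by (intro sum_mono) (auto simp: not_less)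
    then have "(L - r) * card ({..<n} - ?G) \<le> n * L - (\<Sum>k<n. x k)"
      by (simp add: sum_distrib_left[symmetric] sum_of_bool_eq sum_subtractf set_diff_eq Int_def)
    then have "(L - r) * card ({..<n} - ?G) / n \<le> (n * L - (\<Sum>k<n. x k)) / n"
      by (rule divide_right_mono) simp
    then have "(L - r) * (1 - rho_upto n ?G) \<le> L - (\<Sum>k<n. x k) / n"
      using that by (simp add: one_minus_rho_upto diff_divide_distrib)
    then show ?thesis using \<open>r < L\<close> by (simp add: field_simps)
  qed
  then show "\<forall>\<^sub>F n in sequentially. 1 - (L - (\<Sum>k<n. x k) / n) / (L - r) \<le> rho_upto n ?G"
    by (intro eventually_mono[OF eventually_gt_at_top[of 0]])
  show "\<forall>\<^sub>F n in sequentially. rho_upto n ?G \<le> 1" by (simp add: rho_upto_le_1)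
  have "(\<lambda>n. 1 - (L - (\<Sum>k<n. x k) / n) / (L - r)) \<longlonglongrightarrow> 1 - (L - L) / (L - r)"
    using \<open>r < L\<close> by (intro tendsto_intros mean) simp
  then show "(\<lambda>n. 1 - (L - (\<Sum>k<n. x k) / n) / (L - r)) \<longlonglongrightarrow> 1" by simp
qed simp

lemma sets_has_density_1:
  assumes [measurable]: "\<And>k. S k \<in> sets M"
  shows "{x \<in> space M. has_density {k. x \<in> S k} 1} \<in> sets M"
proof -
  have "card ({..<n} - {k. x \<in> S k}) = (\<Sum>k<n. if x \<in> S k then 0 else 1)" for n x
    by (simp add: sum.If_cases set_diff_eq Int_def)
  then show ?thesis unfolding has_density_1_iff by measurable
qed

lemma (in finite_measure) mean_measure_Int_tendsto:
  assumes [measurable]: "E \<in> sets M" "\<And>k. S k \<in> sets M"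
    and density: "\<And>x. x \<in> E \<Longrightarrow> has_density {k. x \<in> S k} r"
  shows "(\<lambda>n. (\<Sum>k<n. measure M (E \<inter> S k)) / n) \<longlonglongrightarrow> measure M E * r"
proof -
  define g where "g n x = (\<Sum>k<n. indicator (E \<inter> S k) x) / real n" for n x
  have g_eq: "g n x = indicator E x * rho_upto n {k. x \<in> S k}" for n x
  proof -
    have "real (card ({k. x \<in> S k} \<inter> {0..<n})) = (\<Sum>k<n. indicator (S k) x)"
      by (simp add: indicator_def sum.If_cases Int_def lessThan_atLeast0 conj_commute)
    then show ?thesis
      by (simp add: g_def rho_upto_def indicator_inter_arith sum_distrib_left)
  qed
  have "(\<lambda>n. \<integral>x. g n x \<partial>M) \<longlonglongrightarrow> (\<integral>x. indicator E x * r \<partial>M)"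
  proof (rule integral_dominated_convergence[where w = "\<lambda>_. 1"])
    show "AE x in M. (\<lambda>n. g n x) \<longlonglongrightarrow> indicator E x * r"
      using density by (intro AE_I2) (auto simp: g_eq has_density_def indicator_def)
    show "AE x in M. norm (g n x) \<le> 1" for n
      by (intro AE_I2) (auto simp: g_eq indicator_def rho_upto_le_1 rho_upto_nonneg)
  qed (auto simp: g_def)
  moreover have "(\<integral>x. g n x \<partial>M) = (\<Sum>k<n. measure M (E \<inter> S k)) / n" for n
    by (simp add: g_def Bochner_Integration.integral_sum emeasure_eq_measure sets.sets_into_space)
  moreover have "(\<integral>x. indicator E x * r \<partial>M) = measure M E * r"
    by simp
  ultimately show ?thesis by simp
qed

lemma (in finite_measure) has_density_1_measure_Int_greater:
  assumes "E \<in> sets M" "\<And>k. S k \<in> sets M"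
    and "\<And>x. x \<in> E \<Longrightarrow> has_density {k. x \<in> S k} 1" and "r < measure M E"
  shows "has_density {k. r < measure M (E \<inter> S k)} 1"
proof (rule has_density_1_if_mean_tendsto_upper_bound)
  show "measure M (E \<inter> S k) \<le> measure M E" for k
    using assms(1) by (intro finite_measure_mono) auto
  show "(\<lambda>n. (\<Sum>k<n. measure M (E \<inter> S k)) / n) \<longlonglongrightarrow> measure M E"
    using mean_measure_Int_tendsto[OF assms(1-3)] by simp
qed (rule assms(4))

lemma (in finite_measure) measure_Int_gt_half_not_disjoint:
  assumes [measurable]: "B \<in> sets M" "S \<in> sets M" "T \<in> sets M"
    and "measure M B / 2 < measure M (B \<inter> S)" "measure M B / 2 < measure M (B \<inter> T)"
  shows "S \<inter> T \<noteq> {}"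
proof
  assume "S \<inter> T = {}"
  then have "measure M (B \<inter> S) + measure M (B \<inter> T) = measure M ((B \<inter> S) \<union> (B \<inter> T))"
    by (intro finite_measure_Union[symmetric]) auto
  also have "\<dots> \<le> measure M B" by (intro finite_measure_mono) auto
  finally show False using assms(4,5) by simp
qed

section \<open>Approximation by a generating algebra\<close>

lemma (in finite_measure) measure_sym_diff_UN_le:
  fixes A :: "nat \<Rightarrow> 'a set"
  assumes [measurable]: "\<And>i. A i \<in> sets M" "\<And>i. B i \<in> sets M" "C \<in> sets M"
  shows "measure M (sym_diff C (\<Union>i<n. B i)) \<le>
    measure M (sym_diff C (\<Union>i<n. A i)) + (\<Sum>i<n. measure M (sym_diff (A i) (B i)))"
proof -
  have "measure M (sym_diff C (\<Union>i<n. B i)) \<le>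
      measure M (sym_diff C (\<Union>i<n. A i) \<union> (\<Union>i<n. sym_diff (A i) (B i)))"
    by (intro finite_measure_mono) auto
  also have "\<dots> \<le> measure M (sym_diff C (\<Union>i<n. A i)) + measure M (\<Union>i<n. sym_diff (A i) (B i))"
    by (intro measure_Un_le) auto
  also have "measure M (\<Union>i<n. sym_diff (A i) (B i)) \<le> (\<Sum>i<n. measure M (sym_diff (A i) (B i)))"
    by (intro finite_measure_subadditive_finite) auto
  finally show ?thesis by simp
qed

lemma (in finite_measure) measure_sym_diff_UN_finite_tendsto:
  fixes A :: "nat \<Rightarrow> 'a set"
  assumes [measurable]: "\<And>i. A i \<in> sets M"
  shows "(\<lambda>n. measure M (sym_diff (\<Union>i. A i) (\<Union>i<n. A i))) \<longlonglongrightarrow> 0"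
proof -
  have "sym_diff (\<Union>i. A i) (\<Union>i<n. A i) = (\<Union>i. A i) - (\<Union>i<n. A i)" for n by auto
  moreover have "(\<lambda>n. measure M ((\<Union>i. A i) - (\<Union>i<n. A i))) \<longlonglongrightarrow>
      measure M (\<Inter>n. (\<Union>i. A i) - (\<Union>i<n. A i))"
    by (intro finite_Lim_measure_decseq) (auto simp: decseq_def intro: order_less_le_trans)
  moreover have "(\<Inter>n. (\<Union>i. A i) - (\<Union>i<n. A i)) = {}" by blast
  ultimately show ?thesis by (simp only: measure_empty)
qed

lemma (in finite_measure) approximation_UN:
  fixes A :: "nat \<Rightarrow> 'a set"
  assumes \<A>: "algebra (space M) \<A>" "\<A> \<subseteq> sets M" and A: "\<And>i. A i \<in> sets M"
    and approx: "\<And>i \<delta>. 0 < \<delta> \<Longrightarrow> \<exists>B\<in>\<A>. measure M (sym_diff (A i) B) < \<delta>" and "0 < \<epsilon>"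
  shows "\<exists>B\<in>\<A>. measure M (sym_diff (\<Union>i. A i) B) < \<epsilon>"
proof -
  interpret algebra "space M" \<A> by fact
  have "\<forall>\<^sub>F n in sequentially. measure M (sym_diff (\<Union>i. A i) (\<Union>i<n. A i)) < \<epsilon> / 2"
    using measure_sym_diff_UN_finite_tendsto[OF A] \<open>0 < \<epsilon>\<close>
    by (intro order_tendstoD(2)[where y = 0]) auto
  then obtain n where n: "measure M (sym_diff (\<Union>i. A i) (\<Union>i<n. A i)) < \<epsilon> / 2"
    by (auto simp: eventually_sequentially)
  have "\<forall>i. \<exists>B\<in>\<A>. measure M (sym_diff (A i) B) < \<epsilon> / (2 * Suc n)"
    using approx \<open>0 < \<epsilon>\<close> by simp
  then obtain B where B: "\<And>i. B i \<in> \<A>" "\<And>i. measure M (sym_diff (A i) (B i)) < \<epsilon> / (2 * Suc n)"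
    by metis
  have "(\<Sum>i<n. measure M (sym_diff (A i) (B i))) \<le> (\<Sum>i<n. \<epsilon> / (2 * Suc n))"
    using B(2) by (intro sum_mono less_imp_le)
  also have "\<dots> \<le> \<epsilon> / 2" using \<open>0 < \<epsilon>\<close> by (simp add: field_simps)
  finally have "measure M (sym_diff (\<Union>i. A i) (\<Union>i<n. B i)) < \<epsilon>"
    using measure_sym_diff_UN_le[of A B "\<Union>i. A i" n] n A B(1) \<A>(2) by fastforce
  with B(1) show ?thesis by (intro bexI[of _ "\<Union>i<n. B i"]) auto
qed

lemma (in finite_measure) approximation_by_generating_algebra:
  assumes "algebra (space M) \<A>" and generates: "sets M = sigma_sets (space M) \<A>"
    and "A \<in> sets M" and "0 < \<epsilon>"
  shows "\<exists>B\<in>\<A>. measure M (sym_diff A B) < \<epsilon>"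
proof -
  interpret algebra "space M" \<A> by fact
  have sets_\<A>: "B \<in> sets M" if "B \<in> \<A>" for B
    using that generates by (auto intro: sigma_sets.Basic)
  from \<open>A \<in> sets M\<close> have "A \<in> sigma_sets (space M) \<A>" by (simp add: generates)
  then show ?thesis using \<open>0 < \<epsilon>\<close>
  proof (induction arbitrary: \<epsilon>)
    case (Basic A)
    then show ?case by (intro bexI[of _ A]) auto
  next
    case Empty
    then show ?case by (intro bexI[of _ "{}"]) auto
  next
    case (Compl A)
    then obtain B where B: "B \<in> \<A>" "measure M (sym_diff A B) < \<epsilon>" by blast
    have "A \<subseteq> space M" "B \<subseteq> space M"
      using Compl.hyps B(1) sets_into_space sigma_sets_into_sp[OF space_closed] by auto
    then have "sym_diff (space M - A) (space M - B) = sym_diff A B" by auto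
    with B show ?case by (intro bexI[of _ "space M - B"]) auto
  next
    case (Union A)
    then show ?case
      using generates sets_\<A> by (intro approximation_UN algebra_axioms) auto
  qed
qed

lemma (in finite_measure) generating_algebra_large_relative_measure:
  assumes \<A>: "algebra (space M) \<A>" "sets M = sigma_sets (space M) \<A>"
    and [measurable]: "C \<in> sets M" and pos: "0 < measure M C" and "0 \<le> r" "r < 1"
  shows "\<exists>B\<in>\<A>. r * measure M B < measure M (C \<inter> B)"
proof -
  have "0 < (1 - r) / 2 * measure M C" using pos \<open>r < 1\<close> by simp
  then obtain B where "B \<in> \<A>" and approx: "measure M (sym_diff C B) < (1 - r) / 2 * measure M C"
    using approximation_by_generating_algebra[OF \<A> \<open>C \<in> sets M\<close>] by blast
  have [measurable]: "B \<in> sets M" using \<open>B \<in> \<A>\<close> \<A>(2) by (simp add: sigma_sets.Basic)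
  have Int_Diff: "measure M A = measure M (A \<inter> D) + measure M (A - D)"
    if "A \<in> sets M" "D \<in> sets M" for A D
    using that by (subst finite_measure_Union[symmetric]) (auto simp: Int_Diff_Un)
  have decompositions: "measure M C = measure M (C \<inter> B) + measure M (C - B)"
      "measure M B = measure M (C \<inter> B) + measure M (B - C)"
      "measure M (sym_diff C B) = measure M (C - B) + measure M (B - C)"
    using Int_Diff[of C B] Int_Diff[of B C] finite_measure_Union[of "C - B" "B - C"]
    by (auto simp: Int_commute)
  have "r * (a + c) < a" if "b + c < (1 - r) / 2 * (a + b)" "0 \<le> b" "0 \<le> c" for a b c :: real
  proof -
    have "0 \<le> r * b" "r * c \<le> c"
      using that \<open>0 \<le> r\<close> \<open>r < 1\<close> by (auto intro: mult_left_le_one_le)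
    with that show ?thesis by (simp add: field_simps)
  qed
  with approx have "r * measure M B < measure M (C \<inter> B)"
    unfolding decompositions by (simp only: measure_nonneg)
  with \<open>B \<in> \<A>\<close> show ?thesis ..
qed

section \<open>Coin flips and cylinders\<close>

abbreviation coin_flips :: "(nat \<Rightarrow> bool) measure" where
  "coin_flips \<equiv> PiM UNIV (\<lambda>_. measure_pmf (bernoulli_pmf (1 / 2)))"

interpretation coin: product_prob_space "\<lambda>_ :: nat. measure_pmf (bernoulli_pmf (1 / 2))" UNIV
  by (intro product_prob_spaceI prob_space_measure_pmf)

lemma space_coin_flips [simp]: "space coin_flips = UNIV"
  by (simp add: space_PiM)

definition prefix_code :: "nat \<Rightarrow> (nat \<Rightarrow> bool) \<Rightarrow> nat" where
  "prefix_code l X = horner_sum of_bool 2 (map X [0..<l])"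

lemma bit_prefix_code: "bit (prefix_code l X) i \<longleftrightarrow> i < l \<and> X i"
  by (auto simp: prefix_code_def bit_horner_sum_bit_iff)

lemma prefix_code_less: "prefix_code l X < 2 ^ l"
  using horner_sum_bound[of "map X [0..<l]"] by (simp add: prefix_code_def)

lemma take_bit_prefix_code: "l \<le> s \<Longrightarrow> take_bit l (prefix_code s X) = prefix_code l X"
  by (rule bit_eqI) (auto simp: bit_take_bit_iff bit_prefix_code)

lemma prefix_code_eq_iff:
  assumes "\<sigma> < 2 ^ l"
  shows "prefix_code l X = \<sigma> \<longleftrightarrow> (\<forall>i<l. X i = bit \<sigma> i)"
proof
  assume "\<forall>i<l. X i = bit \<sigma> i"
  then have "prefix_code l X = take_bit l \<sigma>"
    by (intro bit_eqI) (auto simp: bit_take_bit_iff bit_prefix_code)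
  then show "prefix_code l X = \<sigma>" using assms by (simp add: take_bit_nat_eq_self)
qed (auto simp: bit_prefix_code)

definition cylinder :: "nat \<Rightarrow> nat \<Rightarrow> (nat \<Rightarrow> bool) set" where
  "cylinder l \<sigma> = {X. prefix_code l X = \<sigma>}"

lemma prod_emb_PiE_singletons:
  "prod_emb UNIV (\<lambda>_. measure_pmf p) J (PiE J (\<lambda>i. {g i})) = {X. \<forall>i\<in>J. X i = g i}"
  by (auto simp: prod_emb_def PiE_iff)

lemma cylinder_eq_prod_emb:
  assumes "\<sigma> < 2 ^ l"
  shows "cylinder l \<sigma> = prod_emb UNIV (\<lambda>_. measure_pmf (bernoulli_pmf (1 / 2))) {..<l}
    (PiE {..<l} (\<lambda>i. {bit \<sigma> i}))"
  unfolding cylinder_def prefix_code_eq_iff[OF assms] prod_emb_PiE_singletons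
  by (simp add: Ball_def)

lemma measure_cylinder:
  assumes "\<sigma> < 2 ^ l"
  shows "measure coin_flips (cylinder l \<sigma>) = 1 / 2 ^ l"
proof -
  have "measure coin_flips (cylinder l \<sigma>) =
      (\<Prod>i<l. measure (measure_pmf (bernoulli_pmf (1 / 2))) {bit \<sigma> i})"
    unfolding cylinder_eq_prod_emb[OF assms] by (intro coin.measure_PiM_emb) auto
  also have "\<dots> = (\<Prod>i<l. 1 / 2)"
    by (intro prod.cong refl) (simp add: measure_pmf_single pmf_bernoulli_half)
  finally show ?thesis by (simp add: power_one_over)
qed

lemma sets_cylinder: "cylinder l \<sigma> \<in> sets coin_flips"
proof (cases "\<sigma> < 2 ^ l")
  case True
  then show ?thesis unfolding cylinder_eq_prod_emb[OF True] by (intro sets_PiM_I) auto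
next
  case False
  then have "cylinder l \<sigma> = {}" using prefix_code_less by (auto simp: cylinder_def)
  then show ?thesis by simp
qed

lemma measurable_prefix_code [measurable]:
  "prefix_code l \<in> coin_flips \<rightarrow>\<^sub>M count_space UNIV"
  using sets_cylinder by (auto simp: measurable_count_space_eq2_countable cylinder_def vimage_def)

lemma measure_prefix_code_vimage:
  "measure coin_flips {X. prefix_code l X \<in> S} = card (S \<inter> {..<2 ^ l}) / 2 ^ l"
proof -
  have "{X. prefix_code l X \<in> S} = (\<Union>\<sigma>\<in>S \<inter> {..<2 ^ l}. cylinder l \<sigma>)"
    using prefix_code_less by (auto simp: cylinder_def)
  moreover have "disjoint_family_on (cylinder l) (S \<inter> {..<2 ^ l})"
    by (auto simp: disjoint_family_on_def cylinder_def)
  ultimately have "measure coin_flips {X. prefix_code l X \<in> S} =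
      (\<Sum>\<sigma>\<in>S \<inter> {..<2 ^ l}. measure coin_flips (cylinder l \<sigma>))"
    using sets_cylinder by (simp add: coin.finite_measure_finite_Union image_subset_iff)
  then show ?thesis by (simp add: measure_cylinder)
qed

definition clopen_sets :: "(nat \<Rightarrow> bool) set set" where
  "clopen_sets = {{X. prefix_code l X \<in> S} | l S. True}"

lemma clopen_setsI: "{X. prefix_code l X \<in> S} \<in> clopen_sets"
  unfolding clopen_sets_def by blast

lemma clopen_setsE:
  assumes "A \<in> clopen_sets"
  obtains l S where "A = {X. prefix_code l X \<in> S}"
  using assms unfolding clopen_sets_def by blast

lemma algebra_clopen_sets: "algebra UNIV clopen_sets"
proof -
  have "A \<union> B \<in> clopen_sets" if "A \<in> clopen_sets" "B \<in> clopen_sets" for A B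
  proof -
    obtain l S where A: "A = {X. prefix_code l X \<in> S}"
      using \<open>A \<in> clopen_sets\<close> by (rule clopen_setsE)
    obtain m T where B: "B = {X. prefix_code m X \<in> T}"
      using \<open>B \<in> clopen_sets\<close> by (rule clopen_setsE)
    have "A \<union> B = {X. prefix_code (max l m) X \<in> {\<sigma>. take_bit l \<sigma> \<in> S \<or> take_bit m \<sigma> \<in> T}}"
      by (auto simp: A B take_bit_prefix_code)
    then show ?thesis by (simp only: clopen_setsI)
  qed
  moreover have "- A \<in> clopen_sets" if "A \<in> clopen_sets" for A
  proof -
    obtain l S where "A = {X. prefix_code l X \<in> S}"
      using \<open>A \<in> clopen_sets\<close> by (rule clopen_setsE)
    then have "- A = {X. prefix_code l X \<in> - S}" by auto
    then show ?thesis by (simp only: clopen_setsI)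
  qed
  moreover have "{} \<in> clopen_sets" using clopen_setsI[of 0 "{}"] by simp
  ultimately show ?thesis by (simp add: algebra_iff_Un Compl_eq_Diff_UNIV[symmetric])
qed

lemma sets_coin_flips_eq_sigma_clopen: "sets coin_flips = sigma_sets UNIV clopen_sets"
proof
  have "clopen_sets \<subseteq> sets coin_flips"
    using measurable_sets[OF measurable_prefix_code]
    by (fastforce simp: vimage_def elim: clopen_setsE)
  then show "sigma_sets UNIV clopen_sets \<subseteq> sets coin_flips"
    using sets.sigma_sets_subset[of clopen_sets coin_flips] by simp
next
  have "{X. X i \<in> A} \<in> clopen_sets" for i and A :: "bool set"
  proof -
    have "{X. X i \<in> A} = {X. prefix_code (Suc i) X \<in> {\<sigma>. bit \<sigma> i \<in> A}}"
      by (simp add: bit_prefix_code)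
    then show ?thesis by (simp only: clopen_setsI)
  qed
  then show "sets coin_flips \<subseteq> sigma_sets UNIV clopen_sets"
    by (auto simp: sets_PiM_single intro!: sigma_sets_mono')
qed

lemma cylinder_of_large_relative_measure:
  assumes "C \<in> sets coin_flips" and "0 < measure coin_flips C" and "0 \<le> r" "r < 1"
  obtains l \<sigma> where "\<sigma> < 2 ^ l"
    "r * measure coin_flips (cylinder l \<sigma>) < measure coin_flips (C \<inter> cylinder l \<sigma>)"
proof -
  let ?\<mu> = "measure coin_flips"
  obtain B where "B \<in> clopen_sets" and B: "r * ?\<mu> B < ?\<mu> (C \<inter> B)"
    using coin.generating_algebra_large_relative_measure[of clopen_sets C r] assms
    by (auto simp: algebra_clopen_sets sets_coin_flips_eq_sigma_clopen[symmetric])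
  then obtain l S where "B = {X. prefix_code l X \<in> S}" by (elim clopen_setsE)
  then have B_eq: "D \<inter> B = (\<Union>\<sigma>\<in>S \<inter> {..<2 ^ l}. D \<inter> cylinder l \<sigma>)" for D
    using prefix_code_less by (auto simp: cylinder_def)
  have sum: "?\<mu> (D \<inter> B) = (\<Sum>\<sigma>\<in>S \<inter> {..<2 ^ l}. ?\<mu> (D \<inter> cylinder l \<sigma>))"
    if "D \<in> sets coin_flips" for D
    unfolding B_eq using that sets_cylinder
    by (intro coin.finite_measure_finite_Union) (auto simp: disjoint_family_on_def cylinder_def)
  have sum_UNIV: "?\<mu> B = (\<Sum>\<sigma>\<in>S \<inter> {..<2 ^ l}. ?\<mu> (cylinder l \<sigma>))"
    using sum[of UNIV] sets.top[of coin_flips] by simp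
  have "\<exists>\<sigma><2 ^ l. r * ?\<mu> (cylinder l \<sigma>) < ?\<mu> (C \<inter> cylinder l \<sigma>)"
  proof (rule ccontr)
    assume "\<not> (\<exists>\<sigma><2 ^ l. r * ?\<mu> (cylinder l \<sigma>) < ?\<mu> (C \<inter> cylinder l \<sigma>))"
    then have "?\<mu> (C \<inter> B) \<le> r * ?\<mu> B"
      unfolding sum[OF assms(1)] sum_UNIV sum_distrib_left by (intro sum_mono) auto
    with B show False by simp
  qed
  then show ?thesis using that by blast
qed

section \<open>Classes of positive measure: majority vote\<close>

definition computes_densely :: "recf \<Rightarrow> (nat \<Rightarrow> nat) \<Rightarrow> (nat \<Rightarrow> bool) set" where
  "computes_densely c f = {X. dense_description (\<lambda>n. run (char_fun X) c [n]) f}"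

lemma densely_computable_in_iff: "densely_computable_in X f \<longleftrightarrow> (\<exists>c. X \<in> computes_densely c f)"
proof -
  have "(\<forall>n. run (char_fun X) c [n] = d n) \<longleftrightarrow> d = (\<lambda>n. run (char_fun X) c [n])" for c d
    by auto
  then show ?thesis
    unfolding densely_computable_in_def partial_computable_in_def computes_densely_def by auto
qed

lemma bounded_run_prefix_code:
  "bounded_run (char_fun (bit (prefix_code s X))) s c xs = bounded_run (char_fun X) s c xs"
  by (rule bounded_run_cong) (simp add: char_fun_def bit_prefix_code)

lemma measurable_bounded_run [measurable]:
  "(\<lambda>X. bounded_run (char_fun X) s c xs) \<in> coin_flips \<rightarrow>\<^sub>M count_space UNIV"
  using measurable_compose[OF measurable_prefix_code[of s],
      where g = "\<lambda>\<sigma>. bounded_run (char_fun (bit \<sigma>)) s c xs" and L = "count_space UNIV"]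
  by (simp add: bounded_run_prefix_code)

lemma sets_run [measurable]: "{X. run (char_fun X) c xs = Some v} \<in> sets coin_flips"
proof -
  have "{X \<in> space coin_flips. \<exists>s. bounded_run (char_fun X) s c xs = Suc v} \<in> sets coin_flips"
    by measurable
  then show ?thesis by (simp add: run_eq_Some_iff)
qed

lemma sets_computes_densely: "computes_densely c f \<in> sets coin_flips"
  using sets_has_density_1[of "\<lambda>k. {X. run (char_fun X) c [k] = Some (f k)}" coin_flips] sets_run
  by (simp add: computes_densely_def dense_description_def)

lemma measure_bounded_run_tendsto:
  assumes [measurable]: "B \<in> sets coin_flips"
  shows "(\<lambda>s. measure coin_flips (B \<inter> {X. bounded_run (char_fun X) s c xs = Suc v})) \<longlonglongrightarrow>
    measure coin_flips (B \<inter> {X. run (char_fun X) c xs = Some v})"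
proof -
  let ?T = "\<lambda>s. B \<inter> {X. bounded_run (char_fun X) s c xs = Suc v}"
  have "(\<lambda>s. measure coin_flips (?T s)) \<longlonglongrightarrow> measure coin_flips (\<Union>s. ?T s)"
    by (intro coin.finite_Lim_measure_incseq) (auto simp: incseq_def intro: bounded_run_mono)
  moreover have "(\<Union>s. ?T s) = B \<inter> {X. run (char_fun X) c xs = Some v}"
    by (auto simp: run_eq_Some_iff)
  ultimately show ?thesis by simp
qed

lemma less_measure_run_iff:
  assumes B: "B \<in> sets coin_flips"
  shows "r < measure coin_flips (B \<inter> {X. run (char_fun X) c xs = Some v}) \<longleftrightarrow>
    (\<exists>t. r < measure coin_flips (B \<inter> {X. bounded_run (char_fun X) (t + l) c xs = Suc v}))"
proof
  assume "r < measure coin_flips (B \<inter> {X. run (char_fun X) c xs = Some v})"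
  then have "\<forall>\<^sub>F t in sequentially.
      r < measure coin_flips (B \<inter> {X. bounded_run (char_fun X) (t + l) c xs = Suc v})"
    using LIMSEQ_ignore_initial_segment[OF measure_bounded_run_tendsto[OF B]]
    by (rule order_tendstoD(1)[rotated])
  then show "\<exists>t. r < measure coin_flips (B \<inter> {X. bounded_run (char_fun X) (t + l) c xs = Suc v})"
    by (auto simp: eventually_sequentially)
next
  assume "\<exists>t. r < measure coin_flips (B \<inter> {X. bounded_run (char_fun X) (t + l) c xs = Suc v})"
  then obtain t
    where "r < measure coin_flips (B \<inter> {X. bounded_run (char_fun X) (t + l) c xs = Suc v})" ..
  also have "\<dots> \<le> measure coin_flips (B \<inter> {X. run (char_fun X) c xs = Some v})"
    using B by (intro coin.finite_measure_mono) (auto intro: bounded_run_sound)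
  finally show "r < measure coin_flips (B \<inter> {X. run (char_fun X) c xs = Some v})" .
qed

definition vote_count :: "recf \<Rightarrow> nat \<Rightarrow> nat \<Rightarrow> nat \<Rightarrow> nat \<Rightarrow> nat \<Rightarrow> nat" where
  "vote_count c l \<sigma> s k m = (\<Sum>\<tau><2 ^ s.
     of_bool (take_bit l \<tau> = \<sigma> \<and> bounded_run (char_fun (bit \<tau>)) s c [k] = Suc m))"

lemma measure_eq_vote_count:
  assumes "l \<le> s"
  shows "measure coin_flips (cylinder l \<sigma> \<inter> {X. bounded_run (char_fun X) s c [k] = Suc m}) =
    vote_count c l \<sigma> s k m / 2 ^ s"
proof -
  let ?V = "{\<tau>. take_bit l \<tau> = \<sigma> \<and> bounded_run (char_fun (bit \<tau>)) s c [k] = Suc m}"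
  have "cylinder l \<sigma> \<inter> {X. bounded_run (char_fun X) s c [k] = Suc m} = {X. prefix_code s X \<in> ?V}"
    using assms by (auto simp: cylinder_def take_bit_prefix_code bounded_run_prefix_code)
  then show ?thesis
    by (simp only: measure_prefix_code_vimage)
      (simp add: vote_count_def sum_of_bool_eq Int_commute)
qed

lemma computable_vote_count:
  assumes "computable q a S" "computable q a K" "computable q a M"
  shows "computable q a (\<lambda>Z e. vote_count c l \<sigma> (S Z e) (K Z e) (M Z e))"
  unfolding vote_count_def char_fun_def[abs_def]
  by (intro computable_intros computable_bounded_run computable_weaken assms) auto

definition majority :: "recf \<Rightarrow> nat \<Rightarrow> nat \<Rightarrow> nat \<Rightarrow> nat \<Rightarrow> nat \<Rightarrow> bool" where
  "majority c l \<sigma> k m t \<longleftrightarrow> 2 ^ (t + l) < 2 * 2 ^ l * vote_count c l \<sigma> (t + l) k m"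

lemma majority_iff_measure:
  assumes "\<sigma> < 2 ^ l"
  shows "majority c l \<sigma> k m t \<longleftrightarrow> measure coin_flips (cylinder l \<sigma>) / 2 <
    measure coin_flips (cylinder l \<sigma> \<inter> {X. bounded_run (char_fun X) (t + l) c [k] = Suc m})"
proof -
  have "majority c l \<sigma> k m t \<longleftrightarrow>
      real (2 ^ (t + l)) < real (2 * 2 ^ l * vote_count c l \<sigma> (t + l) k m)"
    unfolding majority_def of_nat_less_iff ..
  also have "\<dots> \<longleftrightarrow> 1 / 2 ^ l / 2 < vote_count c l \<sigma> (t + l) k m / 2 ^ (t + l)"
    by (simp add: field_simps)
  finally show ?thesis
    unfolding measure_cylinder[OF assms] by (simp only: measure_eq_vote_count le_add2)
qed

lemma majority_value_code:
  assumes "\<sigma> < 2 ^ l"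
  obtains d where "oracle_free d"
    "\<And>Z k m. run Z d [k] = Some m \<longleftrightarrow> measure coin_flips (cylinder l \<sigma>) / 2 <
      measure coin_flips (cylinder l \<sigma> \<inter> {X. run (char_fun X) c [k] = Some m})"
proof -
  let ?M = "majority c l \<sigma>"
  have ex_majority_iff: "(\<exists>t. ?M k m t) \<longleftrightarrow> measure coin_flips (cylinder l \<sigma>) / 2 <
      measure coin_flips (cylinder l \<sigma> \<inter> {X. run (char_fun X) c [k] = Some m})" for k m
    unfolding majority_iff_measure[OF assms]
    by (rule less_measure_run_iff[symmetric]) (rule sets_cylinder)
  have single_valued: "m = m'" if "?M k m t" "?M k m' t'" for k m m' t t'
  proof -
    have "{X. run (char_fun X) c [k] = Some m} \<inter> {X. run (char_fun X) c [k] = Some m'} \<noteq> {}"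
      using that ex_majority_iff
      by (intro coin.measure_Int_gt_half_not_disjoint[of "cylinder l \<sigma>"] sets_cylinder sets_run)
        blast+
    then show ?thesis by auto
  qed
  have "computable False 3 (\<lambda>Z e. of_bool (?M (e 0) (e 1) (e 2)))"
    unfolding majority_def by (intro computable_intros computable_vote_count) auto
  then obtain d where "False \<or> oracle_free d"
    and run_d: "\<And>Z k m. (\<And>m m' t t'. \<lbrakk>?M k m t; ?M k m' t'\<rbrakk> \<Longrightarrow> m = m') \<Longrightarrow>
      run Z d [k] = Some m \<longleftrightarrow> (\<exists>t. ?M k m t)"
    by (rule semidecidable_graph_code) blast
  then show ?thesis
    using run_d[OF single_valued] by (intro that) (simp_all add: ex_majority_iff)
qed

lemma densely_computable_if_positive_measure:
  assumes pos: "0 < measure coin_flips (computes_densely c f)"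
  shows "densely_computable f"
proof -
  let ?\<mu> = "measure coin_flips"
  let ?S = "\<lambda>k. {X. run (char_fun X) c [k] = Some (f k)}"
  obtain l \<sigma> where "\<sigma> < 2 ^ l"
    and large: "1 / 2 * ?\<mu> (cylinder l \<sigma>) < ?\<mu> (computes_densely c f \<inter> cylinder l \<sigma>)"
    by (rule cylinder_of_large_relative_measure[OF sets_computes_densely pos, of "1 / 2"]) auto
  obtain d where "oracle_free d" and run_d: "\<And>Z k m. run Z d [k] = Some m \<longleftrightarrow>
      ?\<mu> (cylinder l \<sigma>) / 2 < ?\<mu> (cylinder l \<sigma> \<inter> {X. run (char_fun X) c [k] = Some m})"
    using majority_value_code[OF \<open>\<sigma> < 2 ^ l\<close>, of c] by blast
  define E where "E = computes_densely c f \<inter> cylinder l \<sigma>"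
  have "has_density {k. ?\<mu> (cylinder l \<sigma>) / 2 < ?\<mu> (E \<inter> ?S k)} 1"
  proof (rule coin.has_density_1_measure_Int_greater)
    show "E \<in> sets coin_flips"
      unfolding E_def by (intro sets.Int sets_computes_densely sets_cylinder)
    show "has_density {k. X \<in> ?S k} 1" if "X \<in> E" for X
      using that by (simp add: E_def computes_densely_def dense_description_def)
  qed (use large in \<open>simp_all add: E_def sets_run\<close>)
  moreover have "?\<mu> (E \<inter> ?S k) \<le> ?\<mu> (cylinder l \<sigma> \<inter> ?S k)" for k
    using sets_cylinder sets_run by (intro coin.finite_measure_mono) (auto simp: E_def)
  ultimately have "dense_description (\<lambda>k. run (\<lambda>_. 0) d [k]) f"
    unfolding dense_description_def run_d
    by (elim has_density_1_mono) (auto intro: order_less_le_trans)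
  with \<open>oracle_free d\<close> show ?thesis
    unfolding densely_computable_def partial_computable_def by auto
qed

lemma null_computes_densely:
  assumes "\<not> densely_computable f"
  shows "computes_densely c f \<in> null_sets fair_coin_measure"
proof -
  have "measure coin_flips (computes_densely c f) = 0"
    using densely_computable_if_positive_measure[of c f] assms
    by (metis measure_nonneg order_le_less)
  then have "computes_densely c f \<in> null_sets coin_flips"
    by (intro null_setsI sets_computes_densely) (simp add: coin.emeasure_eq_measure)
  then show ?thesis unfolding fair_coin_measure_def by (rule null_sets_completionI)
qed

instance recf :: countable
  by countable_datatype

lemma null_densely_computable_in:
  assumes "\<not> densely_computable f"
  shows "{X. densely_computable_in X f} \<in> null_sets fair_coin_measure"
proof -
  have "{X. densely_computable_in X f} = (\<Union>c. computes_densely c f)"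
    by (auto simp: densely_computable_in_iff)
  then show ?thesis using null_computes_densely[OF assms] by (simp add: null_sets_UN)
qed

section \<open>The arithmetical complexity of dense computation\<close>

definition disagreement :: "recf \<Rightarrow> (nat \<Rightarrow> nat) \<Rightarrow> (nat \<Rightarrow> nat) \<Rightarrow> nat \<Rightarrow> nat \<Rightarrow> nat" where
  "disagreement c f Z n s = (\<Sum>k<n. of_bool (bounded_run Z s c [k] \<noteq> Suc (f k)))"

lemma disagreement_eq_card:
  "disagreement c f Z n s = card {k. k < n \<and> bounded_run Z s c [k] \<noteq> Suc (f k)}"
  by (simp add: disagreement_def sum_of_bool_eq Int_def)

lemma ex_disagreement_le_iff:
  "(\<exists>s. a * disagreement c f Z n s \<le> b) \<longleftrightarrow>
    a * card ({..<n} - {k. run Z c [k] = Some (f k)}) \<le> b"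
proof -
  let ?A = "{k. run Z c [k] = Some (f k)}"
  have "card ({..<n} - ?A) \<le> disagreement c f Z n s" for s
    unfolding disagreement_eq_card by (intro card_mono) (auto dest: bounded_run_sound)
  moreover have "\<exists>s. disagreement c f Z n s = card ({..<n} - ?A)"
  proof -
    have "\<forall>\<^sub>F s in sequentially. \<forall>k\<in>{..<n} \<inter> ?A. bounded_run Z s c [k] = Suc (f k)"
      by (intro eventually_ball_finite) (auto intro: eventually_bounded_run)
    then obtain s where "\<forall>k\<in>{..<n} \<inter> ?A. bounded_run Z s c [k] = Suc (f k)"
      by (auto simp: eventually_sequentially)
    then have "{k. k < n \<and> bounded_run Z s c [k] \<noteq> Suc (f k)} = {..<n} - ?A"
      by (auto dest: bounded_run_sound)
    then have "disagreement c f Z n s = card ({..<n} - ?A)" by (simp only: disagreement_eq_card)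
    then show ?thesis ..
  qed
  ultimately show ?thesis by (metis mult_le_mono2 order_trans)
qed

lemma computes_densely_iff:
  "X \<in> computes_densely c f \<longleftrightarrow>
     (\<forall>e. \<exists>N. \<forall>n. \<exists>s. N \<le> n \<longrightarrow> Suc e * disagreement c f (char_fun X) n s \<le> n)"
  unfolding computes_densely_def dense_description_def has_density_1_iff mem_Collect_eq
    ex_disagreement_le_iff[symmetric]
  by blast

lemma
  assumes "\<And>xs. length xs = n \<Longrightarrow> R xs = R' xs"
  shows pi_prefix_cong: "pi_prefix n R = pi_prefix n R'"
    and sigma_prefix_cong: "sigma_prefix n R = sigma_prefix n R'"
  using assms
proof (induction n arbitrary: R R')
  case (Suc n)
  {
    case 1
    then show ?case
      using Suc.IH(2)[of "\<lambda>xs. R (x # xs)" "\<lambda>xs. R' (x # xs)" for x] by simp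
  next
    case 2
    then show ?case
      using Suc.IH(1)[of "\<lambda>xs. R (x # xs)" "\<lambda>xs. R' (x # xs)" for x] by simp
  }
qed simp_all

lemma pi_classI:
  assumes "computable True n (\<lambda>Z e. of_bool (R Z e))"
  shows "pi_class n Z {X. pi_prefix n (\<lambda>xs. R (oracle_join (char_fun X) Z) ((!) xs))}"
proof -
  obtain r where run_r: "\<And>Z xs. length xs = n \<Longrightarrow> run Z r xs = Some (of_bool (R Z ((!) xs)))"
    using assms by (rule computableE) metis
  have "pi_prefix n (\<lambda>xs. R Z ((!) xs)) \<longleftrightarrow> pi_prefix n (\<lambda>xs. run Z r xs = Some 1)" for Z
    by (rule pi_prefix_cong) (simp add: run_r)
  then show ?thesis
    unfolding pi_class_def by (intro exI[of _ r]) (simp add: run_r)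
qed

lemma pi_class_computes_densely: "pi_class 4 f (computes_densely c f)"
proof -
  let ?D = "\<lambda>Z n s. disagreement c (\<lambda>k. Z (Suc (2 * k))) (\<lambda>x. Z (2 * x)) n s"
  let ?R = "\<lambda>Z e. e 1 \<le> e 2 \<longrightarrow> Suc (e 0) * ?D Z (e 2) (e 3) \<le> e 2"
  have "computable True 4 (\<lambda>Z e. of_bool (?R Z e))"
    unfolding disagreement_def
    by (intro computable_intros computable_bounded_run computable_query) auto
  then have "pi_class 4 f {X. pi_prefix 4 (\<lambda>xs. ?R (oracle_join (char_fun X) f) ((!) xs))}"
    by (rule pi_classI)
  moreover have "pi_prefix 4 S \<longleftrightarrow> (\<forall>x. \<exists>y. \<forall>z. \<exists>w. S [x, y, z, w])" for S
    by (simp add: eval_nat_numeral)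
  then have "computes_densely c f =
      {X. pi_prefix 4 (\<lambda>xs. ?R (oracle_join (char_fun X) f) ((!) xs))}"
    by (simp add: set_eq_iff computes_densely_iff oracle_join_def del: mult_Suc)
  ultimately show ?thesis by simp
qed

section \<open>Enumeration reducibility to a total function\<close>

lemma enumeration_operator_code:
  assumes W: "enumeration_operator W"
  obtains w where "\<And>u k. (set_decode u, k) \<in> W \<longleftrightarrow> run (\<lambda>_. 0) w [prod_encode (u, k)] \<noteq> None"
proof -
  let ?V = "(\<lambda>(F, k). prod_encode (set_encode F, k)) ` W"
  obtain \<phi> w where "?V = dom \<phi>" "\<And>n. run (\<lambda>_. 0) w [n] = \<phi> n"
    using W unfolding enumeration_operator_def ce_set_def partial_computable_def by blast
  then have V_iff: "x \<in> ?V \<longleftrightarrow> run (\<lambda>_. 0) w [x] \<noteq> None" for x by auto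
  have "(set_decode u, k) \<in> W \<longleftrightarrow> prod_encode (u, k) \<in> ?V" for u k
  proof
    assume "(set_decode u, k) \<in> W"
    then show "prod_encode (u, k) \<in> ?V" by (rule rev_image_eqI) simp
  next
    assume "prod_encode (u, k) \<in> ?V"
    then obtain F where "(F, k) \<in> W" "u = set_encode F" by auto
    moreover have "finite F" using W \<open>(F, k) \<in> W\<close> unfolding enumeration_operator_def by auto
    ultimately show "(set_decode u, k) \<in> W" by simp
  qed
  with V_iff show ?thesis by (intro that) simp
qed

lemma enum_apply_iff:
  assumes "enumeration_operator W"
  shows "k \<in> enum_apply W Y \<longleftrightarrow> (\<exists>u. (set_decode u, k) \<in> W \<and> set_decode u \<subseteq> Y)"
proof -
  have "F = set_decode (set_encode F)" if "(F, k) \<in> W" for F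
    using assms that unfolding enumeration_operator_def by (auto simp: set_encode_inverse)
  then show ?thesis unfolding enum_apply_def by (auto; metis)
qed

lemma gra_total_iff: "j \<in> gra (\<lambda>n. Some (g n)) \<longleftrightarrow> (\<exists>k<Suc j. prod_encode (k, g k) = j)"
  unfolding gra_def using le_prod_encode_1 by (auto simp: less_Suc_eq_le)

lemma set_decode_subset_gra_iff:
  "set_decode u \<subseteq> gra (\<lambda>n. Some (g n)) \<longleftrightarrow>
     (\<forall>j<u. bit u j \<longrightarrow> (\<exists>k<Suc j. prod_encode (k, g k) = j))"
proof -
  have "j < u" if "bit u j" for j
  proof -
    have "2 ^ j \<le> u" using that by (rule contrapos_pp) (simp add: bit_iff_odd)
    with less_exp[of j] show ?thesis by (rule order_less_le_trans)
  qed
  then show ?thesis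
    by (auto simp: set_decode_def bit_iff_odd[symmetric] gra_total_iff subset_eq)
qed

definition enumerated_at_stage :: "recf \<Rightarrow> (nat \<Rightarrow> nat) \<Rightarrow> nat \<Rightarrow> nat \<Rightarrow> bool" where
  "enumerated_at_stage w g k t \<longleftrightarrow>
     (\<exists>u<t. 0 < bounded_run (\<lambda>_. 0) t w [prod_encode (u, k)] \<and>
        (\<forall>j<u. bit u j \<longrightarrow> (\<exists>i<Suc j. prod_encode (i, g i) = j)))"

lemma ex_enumerated_at_stage_iff:
  assumes W: "enumeration_operator W"
    and w: "\<And>u k. (set_decode u, k) \<in> W \<longleftrightarrow> run (\<lambda>_. 0) w [prod_encode (u, k)] \<noteq> None"
  shows "(\<exists>t. enumerated_at_stage w g k t) \<longleftrightarrow> k \<in> enum_apply W (gra (\<lambda>n. Some (g n)))"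
proof
  let ?gra = "gra (\<lambda>n. Some (g n))"
  assume "\<exists>t. enumerated_at_stage w g k t"
  then obtain t u where "0 < bounded_run (\<lambda>_. 0) t w [prod_encode (u, k)]" "set_decode u \<subseteq> ?gra"
    unfolding enumerated_at_stage_def set_decode_subset_gra_iff by blast
  then show "k \<in> enum_apply W ?gra"
    unfolding enum_apply_iff[OF W] w gr0_conv_Suc by (blast dest: bounded_run_sound)
next
  assume "k \<in> enum_apply W (gra (\<lambda>n. Some (g n)))"
  then obtain u v where u: "run (\<lambda>_. 0) w [prod_encode (u, k)] = Some v"
      "set_decode u \<subseteq> gra (\<lambda>n. Some (g n))"
    unfolding enum_apply_iff[OF W] w by blast
  have "\<forall>\<^sub>F t in sequentially. enumerated_at_stage w g k t"
    using eventually_bounded_run[OF u(1)] eventually_gt_at_top[of u]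
  proof eventually_elim
    case (elim t)
    with u(2) show ?case
      unfolding enumerated_at_stage_def set_decode_subset_gra_iff by auto
  qed
  then show "\<exists>t. enumerated_at_stage w g k t" by (auto simp: eventually_sequentially)
qed

lemma partial_computable_in_if_enum_reducible:
  assumes "enum_reducible e (\<lambda>n. Some (g n))"
  shows "partial_computable_in g e"
proof -
  obtain W where W: "enumeration_operator W" "gra e = enum_apply W (gra (\<lambda>n. Some (g n)))"
    using assms unfolding enum_reducible_def by blast
  obtain w where w: "\<And>u k. (set_decode u, k) \<in> W \<longleftrightarrow> run (\<lambda>_. 0) w [prod_encode (u, k)] \<noteq> None"
    using enumeration_operator_code[OF W(1)] by blast
  define P where "P Z n m = enumerated_at_stage w Z (prod_encode (n, m))" for Z n m
  have "e n = Some m \<longleftrightarrow> prod_encode (n, m) \<in> gra e" for n m by (auto simp: gra_def)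
  then have ex_P_iff: "(\<exists>t. P g n m t) \<longleftrightarrow> e n = Some m" for n m
    unfolding P_def by (simp add: ex_enumerated_at_stage_iff[OF W(1) w] W(2))
  have "computable True 3 (\<lambda>Z e. of_bool (P Z (e 0) (e 1) (e 2)))"
    unfolding P_def enumerated_at_stage_def
    by (intro computable_intros computable_bounded_run computable_query) auto
  then obtain c where run_c: "\<And>Z n m. (\<And>m m' t t'. \<lbrakk>P Z n m t; P Z n m' t'\<rbrakk> \<Longrightarrow> m = m') \<Longrightarrow>
      run Z c [n] = Some m \<longleftrightarrow> (\<exists>t. P Z n m t)"
    by (rule semidecidable_graph_code) blast
  have "m = m'" if "P g n m t" "P g n m' t'" for n m m' t t'
    using that ex_P_iff by (metis option.inject)
  from run_c[OF this] have "run g c [n] = Some m \<longleftrightarrow> e n = Some m" for n m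
    by (simp add: ex_P_iff)
  then have "run g c [n] = e n" for n
    by (metis not_None_eq)
  then show ?thesis unfolding partial_computable_in_def by blast
qed

lemma dense_description_total: "dense_description (\<lambda>n. Some (g n)) g"
  by (simp add: dense_description_def has_density_UNIV)

lemma ud_reducible_imp_nd_reducible: "h \<le>\<^sub>u\<^sub>d g \<Longrightarrow> h \<le>\<^sub>n\<^sub>d g"
  unfolding ud_reducible_def nd_reducible_def enum_reducible_def by metis

lemma nd_reducible_imp_densely_computable_in:
  assumes "h \<le>\<^sub>n\<^sub>d char_fun X"
  shows "densely_computable_in X h"
proof -
  obtain e where "dense_description e h" "enum_reducible e (\<lambda>n. Some (char_fun X n))"
    using assms dense_description_total unfolding nd_reducible_def by blast
  then show ?thesis
    unfolding densely_computable_in_def by (blast intro: partial_computable_in_if_enum_reducible)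
qed

lemma null_sets_fair_coin_measure_subset:
  "A \<in> null_sets fair_coin_measure \<Longrightarrow> B \<subseteq> A \<Longrightarrow> B \<in> null_sets fair_coin_measure"
  unfolding fair_coin_measure_def by (rule null_sets_completion_subset)

theorem theorem6p4:
  "(\<forall>f :: nat \<Rightarrow> nat. \<not> densely_computable f \<longrightarrow>
      {X. densely_computable_in X f} \<in> null_sets fair_coin_measure \<and>
      (\<forall>X. densely_computable_in X f \<longrightarrow> \<not> weakly_random 4 f X)) \<and>
   (\<forall>A :: nat \<Rightarrow> bool. \<not> densely_computable (char_fun A) \<longrightarrow>
      {X. char_fun A \<le>\<^sub>u\<^sub>d char_fun X} \<in> null_sets fair_coin_measure \<and>
      {X. char_fun A \<le>\<^sub>n\<^sub>d char_fun X} \<in> null_sets fair_coin_measure)"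
proof (intro conjI allI impI)
  fix f :: "nat \<Rightarrow> nat" assume f: "\<not> densely_computable f"
  show "{X. densely_computable_in X f} \<in> null_sets fair_coin_measure"
    by (rule null_densely_computable_in[OF f])
  show "\<not> weakly_random 4 f X" if "densely_computable_in X f" for X
    using that pi_class_computes_densely null_computes_densely[OF f]
    unfolding densely_computable_in_iff weakly_random_def by blast
next
  fix A :: "nat \<Rightarrow> bool" assume "\<not> densely_computable (char_fun A)"
  note null = null_densely_computable_in[OF this]
  show "{X. char_fun A \<le>\<^sub>n\<^sub>d char_fun X} \<in> null_sets fair_coin_measure"
    using null by (rule null_sets_fair_coin_measure_subset)
      (auto intro: nd_reducible_imp_densely_computable_in)
  show "{X. char_fun A \<le>\<^sub>u\<^sub>d char_fun X} \<in> null_sets fair_coin_measure"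
    using null by (rule null_sets_fair_coin_measure_subset)
      (auto intro: nd_reducible_imp_densely_computable_in ud_reducible_imp_nd_reducible)
qed

end
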